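(* Let $(H,\rho)$ be a complete CAT(0) space with the geodesic extension property, and let $A : H \rightrightarrows TH$ be a monotone vector field satisfying the surjectivity condition, with resolvents $J_\lambda$ ($\lambda\ge 0$). For $t\ge 0$ and $x\in\overline{\operatorname{dom}A}$ put $S(t)x:=\lim_{k\to\infty}J_{t/k}^{k}x$ (this limit exists). Then $\{S(t)\}_{t\ge0}$ is a nonexpansive semigroup on $C:=\overline{\operatorname{dom}A}$; that is: (i) for each $t\ge0$, $S(t)$ maps $C$ into $C$ and is nonexpansive; (ii) $S(s+t)=S(s)\circ S(t)$ for all $s,t\ge0$; (iii) $S(0)$ is the identity mapping on $C$; (iv) for each $x\in C$, the map $t\mapsto S(t)x$ is continuous on $[0,+\infty)$.
   Context: Geodesics. In a complete CAT(0) space $(H,\rho)$, $\gamma_{x,y}:[0,1]\to H$ denotes the unique geodesic from $x$ to $y$ parametrized with constant speed $\rho(x,y)$; it is called a zero geodesic if $x=y$. For a normalized geodesic $\gamma$ (i.e. parametrized on $[0,1]$ with constant speed), $\zeta(\gamma)=0$ if $\gamma$ is a zero geodesic and $\zeta(\gamma)=1$ otherwise. $H$ has the geodesic extension property if for all $p,q\in H$ there is $\eta:\mathbb{R}\to H$ with $\eta(0)=p$, $\eta(1)=q$ and $\rho(\eta(s),\eta(t))=\rho(p,q)|s-t|$ for all $s,t\in\mathbb{R}$. Tangent spaces. For $q,r\ne p$, the comparison angle $\overline\angle_p(q,r)$ is the angle at $\bar p$ in a Euclidean triangle $\bar p\bar q\bar r$ with the same side lengths as $p,q,r$; set $\overline\angle_p(p,p)=0$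 and $\overline\angle_p(p,r)=\overline\angle_p(r,p)=\pi/2$ for $r\neq p$. The Alexandrov angle of geodesics $\gamma_1,\gamma_2$ issuing from $p$ is $\alpha_p(\gamma_1,\gamma_2)=\lim_{s,t\to0^+}\overline\angle_p(\gamma_1(s),\gamma_2(t))$. $S_p$ is the set of normalized geodesics issuing from $p$, modulo the relation $\alpha_p=0$, with induced metric $\angle_p$. $T_pH=([0,\infty)\times S_p)/\!\sim$, where $(t_1,\gamma_1)\sim(t_2,\gamma_2)$ iff either $t_1\zeta(\gamma_1)=t_2\zeta(\gamma_2)=0$, or $t_1\zeta(\gamma_1)=t_2\zeta(\gamma_2)>0$ and $\gamma_1=\gamma_2$ in $S_p$. The class of $(t,\gamma)$ is written $t\gamma$, and $\gamma$ stands for $1\gamma$. Put $g_p(t_1\gamma_1,t_2\gamma_2)=t_1t_2\zeta(\gamma_1)\zeta(\gamma_2)\cos\angle_p(\gamma_1,\gamma_2)$. $TH=\bigcup_{p\in H}T_pH$. Vector fields. A vector field is a set-valued map $A:H\rightrightarrows TH$ with $Ap\subset T_pH$ for all $p$ (possibly empty); $\operatorname{dom}A=\{p: Ap\neq\emptyset\}$. $A$ is monotone if $g_p(\eta,\gamma_{p,q})\le -g_q(\nu,\gamma_{q,p})$ whenever $\eta\in Ap$, $\nu\in Aq$. $A$ satisfies the surjectivity condition if for all $t>0$ and $x\in H$ there is $p\in H$ with $t\rho(p,x)\gamma_{p,x}\in Ap$. For $\lambda>0$, the resolvent is $J_\lambda x=\{z\in H:\lambda^{-1}\rho(z,x)\gamma_{z,x}\in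 Az\}$, which is a singleton for every $x\in H$ when $A$ is monotone with the surjectivity condition, and is then regarded as a map $J_\lambda:H\to H$; $J_0$ is the identity map. $J_\lambda^k$ denotes the $k$-fold composition. A map is nonexpansive if it is $1$-Lipschitz. *)

theory Defs
  imports "HOL-Analysis.Analysis"
begin

section \<open>Geodesics and CAT(0) spaces\<close>

text \<open>Normalized geodesics are maps on the interval from 0 to 1; requiring them to be
  extensional makes them determined by their values there.\<close>

definition is_geodesic :: "(real \<Rightarrow> 'a::metric_space) \<Rightarrow> 'a \<Rightarrow> 'a \<Rightarrow> bool" where
  "is_geodesic c x y \<longleftrightarrow>
     c \<in> extensional {0..1} \<and> c 0 = x \<and> c 1 = y \<and>
     (\<forall>s\<in>{0..1}. \<forall>t\<in>{0..1}. dist (c s) (c t) = dist x y * \<bar>s - t\<bar>)"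

text \<open>The plane \<^typ>\<open>complex\<close> with its usual metric serves as the Euclidean plane. The sides of
  a geodesic triangle are indexed cyclically: side \<open>i\<close> runs from vertex \<open>i\<close> to vertex
  \<open>i + 1\<close> modulo 3.\<close>

definition geodesic_triangle :: "(nat \<Rightarrow> 'a::metric_space) \<Rightarrow> (nat \<Rightarrow> real \<Rightarrow> 'a) \<Rightarrow> bool" where
  "geodesic_triangle v c \<longleftrightarrow> (\<forall>i<3. is_geodesic (c i) (v i) (v ((i + 1) mod 3)))"

definition comparison_triangle :: "(nat \<Rightarrow> 'a::metric_space) \<Rightarrow> (nat \<Rightarrow> complex) \<Rightarrow> bool" where
  "comparison_triangle v w \<longleftrightarrow> (\<forall>i<3. \<forall>j<3. dist (w i) (w j) = dist (v i) (v j))"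

definition comparison_point :: "(nat \<Rightarrow> complex) \<Rightarrow> nat \<Rightarrow> real \<Rightarrow> complex" where
  "comparison_point w i s = (1 - s) *\<^sub>R w i + s *\<^sub>R w ((i + 1) mod 3)"

definition CAT0 :: "'a::metric_space itself \<Rightarrow> bool" where
  "CAT0 _ \<longleftrightarrow>
     (\<forall>x y :: 'a. \<exists>c. is_geodesic c x y) \<and>
     (\<forall>(v :: nat \<Rightarrow> 'a) c w. geodesic_triangle v c \<longrightarrow> comparison_triangle v w \<longrightarrow>
        (\<forall>i<3. \<forall>j<3. \<forall>s\<in>{0..1}. \<forall>t\<in>{0..1}.
           dist (c i s) (c j t) \<le> dist (comparison_point w i s) (comparison_point w j t)))"

definition geodesic_extension_property :: "'a::metric_space itself \<Rightarrow> bool" where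
  "geodesic_extension_property _ \<longleftrightarrow>
     (\<forall>p q :: 'a. \<exists>\<eta> :: real \<Rightarrow> 'a. \<eta> 0 = p \<and> \<eta> 1 = q \<and>
        (\<forall>s t. dist (\<eta> s) (\<eta> t) = dist p q * \<bar>s - t\<bar>))"

text \<open>The geodesic between two points, unique in a CAT(0) space.\<close>

definition geod :: "'a::metric_space \<Rightarrow> 'a \<Rightarrow> real \<Rightarrow> 'a" where
  "geod x y = (THE c. is_geodesic c x y)"

text \<open>A normalized geodesic has constant speed, so it is a zero geodesic iff its endpoints
  coincide.\<close>

definition zeta :: "(real \<Rightarrow> 'a) \<Rightarrow> real" where
  "zeta c = (if c 0 = c 1 then 0 else 1)"


section \<open>Angles\<close>

definition euclidean_angle :: "complex \<Rightarrow> complex \<Rightarrow> complex \<Rightarrow> real" where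
  "euclidean_angle a b c = arccos (((b - a) \<bullet> (c - a)) / (norm (b - a) * norm (c - a)))"

text \<open>In the nondegenerate case a Euclidean triangle with the prescribed side lengths exists by
  the triangle inequality, and its angle depends on the side lengths only.\<close>

definition comparison_angle :: "'a::metric_space \<Rightarrow> 'a \<Rightarrow> 'a \<Rightarrow> real" where
  "comparison_angle p q r =
     (if q = p \<and> r = p then 0
      else if q = p \<or> r = p then pi / 2
      else THE \<theta>. \<exists>a b c. dist a b = dist p q \<and> dist a c = dist p r \<and> dist b c = dist q r \<and>
             \<theta> = euclidean_angle a b c)"

definition alexandrov_angle :: "'a::metric_space \<Rightarrow> (real \<Rightarrow> 'a) \<Rightarrow> (real \<Rightarrow> 'a) \<Rightarrow> real" where
  "alexandrov_angle p c d =
     Lim (at_right 0 \<times>\<^sub>F at_right 0) (\<lambda>(s, t). comparison_angle p (c s) (d t))"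


section \<open>Tangent spaces\<close>

text \<open>Directions and tangent vectors are equivalence classes, represented as sets. Functions of
  classes are defined as the common value on all representatives, via \<^const>\<open>the_elem\<close>.\<close>

type_synonym 'a direction = "(real \<Rightarrow> 'a) set"
type_synonym 'a tangent = "(real \<times> 'a direction) set"

definition geodesics_from :: "'a::metric_space \<Rightarrow> (real \<Rightarrow> 'a) set" where
  "geodesics_from p = {c. \<exists>q. is_geodesic c p q}"

definition direction_rel :: "'a::metric_space \<Rightarrow> ((real \<Rightarrow> 'a) \<times> (real \<Rightarrow> 'a)) set" where
  "direction_rel p =
     {(c, d). c \<in> geodesics_from p \<and> d \<in> geodesics_from p \<and> alexandrov_angle p c d = 0}"

definition direction_space :: "'a::metric_space \<Rightarrow> 'a direction set" where
  "direction_space p = geodesics_from p // direction_rel p"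

definition direction :: "'a::metric_space \<Rightarrow> (real \<Rightarrow> 'a) \<Rightarrow> 'a direction" where
  "direction p c = direction_rel p `` {c}"

definition direction_angle :: "'a::metric_space \<Rightarrow> 'a direction \<Rightarrow> 'a direction \<Rightarrow> real" where
  "direction_angle p X Y = the_elem {alexandrov_angle p c d | c d. c \<in> X \<and> d \<in> Y}"

definition direction_zeta :: "'a direction \<Rightarrow> real" where
  "direction_zeta X = the_elem (zeta ` X)"

definition tangent_rel ::
    "'a::metric_space \<Rightarrow> ((real \<times> 'a direction) \<times> (real \<times> 'a direction)) set" where
  "tangent_rel p =
     {((t1, X1), (t2, X2)). t1 \<ge> 0 \<and> X1 \<in> direction_space p \<and>
        t2 \<ge> 0 \<and> X2 \<in> direction_space p \<and>
        (t1 * direction_zeta X1 = 0 \<and> t2 * direction_zeta X2 = 0 \<or>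
         t1 * direction_zeta X1 = t2 * direction_zeta X2 \<and> t2 * direction_zeta X2 > 0 \<and> X1 = X2)}"

definition tangent_space :: "'a::metric_space \<Rightarrow> 'a tangent set" where
  "tangent_space p = ({0..} \<times> direction_space p) // tangent_rel p"

definition tangent_vector :: "'a::metric_space \<Rightarrow> real \<Rightarrow> (real \<Rightarrow> 'a) \<Rightarrow> 'a tangent" where
  "tangent_vector p t c = tangent_rel p `` {(t, direction p c)}"

definition tangent_inner :: "'a::metric_space \<Rightarrow> 'a tangent \<Rightarrow> 'a tangent \<Rightarrow> real" where
  "tangent_inner p u v =
     the_elem {t1 * t2 * direction_zeta X1 * direction_zeta X2 * cos (direction_angle p X1 X2) |
       t1 X1 t2 X2. (t1, X1) \<in> u \<and> (t2, X2) \<in> v}"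


section \<open>Vector fields and resolvents\<close>

definition vector_field :: "('a::metric_space \<Rightarrow> 'a tangent set) \<Rightarrow> bool" where
  "vector_field A \<longleftrightarrow> (\<forall>p. A p \<subseteq> tangent_space p)"

definition vf_dom :: "('a \<Rightarrow> 'a tangent set) \<Rightarrow> 'a set" where
  "vf_dom A = {p. A p \<noteq> {}}"

definition monotone_vf :: "('a::metric_space \<Rightarrow> 'a tangent set) \<Rightarrow> bool" where
  "monotone_vf A \<longleftrightarrow>
     (\<forall>p q. \<forall>\<eta>\<in>A p. \<forall>\<nu>\<in>A q.
        tangent_inner p \<eta> (tangent_vector p 1 (geod p q))
          \<le> - tangent_inner q \<nu> (tangent_vector q 1 (geod q p)))"

definition surjectivity_condition :: "('a::metric_space \<Rightarrow> 'a tangent set) \<Rightarrow> bool" where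
  "surjectivity_condition A \<longleftrightarrow>
     (\<forall>t>0. \<forall>x. \<exists>p. tangent_vector p (t * dist p x) (geod p x) \<in> A p)"

definition resolvent_set ::
    "('a::metric_space \<Rightarrow> 'a tangent set) \<Rightarrow> real \<Rightarrow> 'a \<Rightarrow> 'a set" where
  "resolvent_set A l x = {z. tangent_vector z (inverse l * dist z x) (geod z x) \<in> A z}"

definition resolvent :: "('a::metric_space \<Rightarrow> 'a tangent set) \<Rightarrow> real \<Rightarrow> 'a \<Rightarrow> 'a" where
  "resolvent A l x = (if l = 0 then x else the_elem (resolvent_set A l x))"

definition resolvent_iter ::
    "('a::metric_space \<Rightarrow> 'a tangent set) \<Rightarrow> real \<Rightarrow> 'a \<Rightarrow> nat \<Rightarrow> 'a" where
  "resolvent_iter A t x k = (resolvent A (t / real k) ^^ k) x"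

definition exp_semigroup ::
    "('a::metric_space \<Rightarrow> 'a tangent set) \<Rightarrow> real \<Rightarrow> 'a \<Rightarrow> 'a" where
  "exp_semigroup A t x = lim (resolvent_iter A t x)"

definition nonexpansive_semigroup :: "'a::metric_space set \<Rightarrow> (real \<Rightarrow> 'a \<Rightarrow> 'a) \<Rightarrow> bool" where
  "nonexpansive_semigroup C S \<longleftrightarrow>
     (\<forall>t\<ge>0. S t ` C \<subseteq> C \<and> 1-lipschitz_on C (S t)) \<and>
     (\<forall>s\<ge>0. \<forall>t\<ge>0. \<forall>x\<in>C. S (s + t) x = S s (S t x)) \<and>
     (\<forall>x\<in>C. S 0 x = x) \<and>
     (\<forall>x\<in>C. continuous_on {0..} (\<lambda>t. S t x))"

end

theory Submission
  imports Defs
begin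

text \<open>In a CAT(0) space the cosine of the angle between two geodesics dominates the cosine of the
  comparison angle, so monotonicity turns into an inequality between squared distances, and the
  quadrilateral inequality makes the resolvents nonexpansive. If \<open>0 < u \<le> l\<close> and \<open>z = J l x\<close>, then
  \<open>z = J u y\<close> for the point \<open>y\<close> that divides the geodesic from \<open>z\<close> to \<open>x\<close> in the ratio
  \<open>u : l - u\<close>, because the geodesics from \<open>z\<close> to \<open>x\<close> and to \<open>y\<close> have the same direction. Convexity of the
  distance then gives the recursion of Crandall and Liggett for the distances between
  iterates \<open>J l ^^ m\<close> and \<open>J u ^^ n\<close>, whose solution bounds them, on the domain of the field, by a
  multiple of \<open>sqrt ((m l - n u)\<^sup>2 + m l u + n u l)\<close>. Hence \<open>(J (l n) ^^ p n) x\<close> converges to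
  \<open>S t x\<close> whenever \<open>l n\<close> tends to \<open>0\<close> and \<open>p n * l n\<close> to \<open>t\<close>; the choice \<open>l n = 1 / n\<close> yields
  the semigroup law.\<close>

section \<open>Euclidean triangles and comparison angles\<close>

lemma dist_convex_combination:
  fixes a b c :: "'b::real_inner"
  shows "(dist ((1 - t) *\<^sub>R a + t *\<^sub>R b) c)\<^sup>2
    = (1 - t) * (dist a c)\<^sup>2 + t * (dist b c)\<^sup>2 - t * (1 - t) * (dist a b)\<^sup>2"
  unfolding dist_norm power2_norm_eq_inner
  by (simp add: algebra_simps inner_commute)

text \<open>Put \<open>p\<close> at 0 and \<open>q\<close> at \<open>a\<close> on the real axis. The
  law of cosines forces the real part \<open>u\<close> of \<open>r\<close>, and the triangle
  inequalities amount to \<open>\<bar>u\<bar> \<le> c\<close>, so that the height is real.\<close>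

lemma euclidean_triangle_exists:
  fixes a b c :: real
  assumes "a \<le> b + c" "b \<le> a + c" "c \<le> a + b"
  obtains p q r :: complex where "dist p q = a" "dist q r = b" "dist p r = c"
proof -
  have nn: "0 \<le> a" "0 \<le> b" "0 \<le> c" using assms by linarith+
  define u where "u = (a\<^sup>2 + c\<^sup>2 - b\<^sup>2) / (2 * a)"
  have au: "2 * a * u = a\<^sup>2 + c\<^sup>2 - b\<^sup>2"
  proof (cases "a = 0")
    \<comment> \<open>Here the assumptions force \<open>b = c\<close>, so both sides are 0.\<close>
    case True
    then show ?thesis using assms by (simp add: antisym)
  qed (simp add: u_def)
  have "\<bar>u\<bar> \<le> c"
  proof (cases "a = 0")
    case True
    then show ?thesis using nn by (simp add: u_def)
  next
    case False
    \<comment> \<open>The factored forms of \<open>(a + c)^2 - b^2\<close> and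
      \<open>b^2 - (a - c)^2\<close>; they bound \<open>2 * a * u\<close> from below and from
      above.\<close>
    have "(c + a - b) * (c + a + b) \<ge> 0" "(b - (a - c)) * (b + (a - c)) \<ge> 0"
      using assms nn by (auto intro!: mult_nonneg_nonneg)
    then have "\<bar>2 * a * u\<bar> \<le> 2 * a * c"
      unfolding au by (simp add: abs_le_iff power2_eq_square algebra_simps)
    then show ?thesis using False nn by (simp add: abs_mult)
  qed
  then have uc: "u\<^sup>2 \<le> c\<^sup>2" by (metis abs_le_square_iff abs_of_nonneg nn(3))
  define r where "r = Complex u (sqrt (c\<^sup>2 - u\<^sup>2))"
  show ?thesis
  proof
    show "dist (0::complex) (of_real a) = a" using nn by (simp add: dist_norm)
    show "dist 0 r = c" using uc nn by (simp add: dist_norm r_def cmod_def)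
    have "dist (of_real a) r = sqrt ((a - u)\<^sup>2 + (sqrt (c\<^sup>2 - u\<^sup>2))\<^sup>2)"
      by (simp add: dist_norm r_def cmod_def)
    also have "(a - u)\<^sup>2 + (sqrt (c\<^sup>2 - u\<^sup>2))\<^sup>2 = b\<^sup>2"
      using uc au by (simp add: power2_diff)
    finally show "dist (of_real a) r = b" using nn by simp
  qed
qed

lemma arccos_0_iff: "-1 \<le> x \<Longrightarrow> x \<le> 1 \<Longrightarrow> arccos x = 0 \<longleftrightarrow> x = 1"
  by (metis arccos_1 arccos_eq_iff abs_le_iff abs_1 le_minus_iff minus_le_iff order_refl)

section \<open>Geodesics and their initial segments\<close>

lemma is_geodesic_dist:
  "is_geodesic c x y \<Longrightarrow> s \<in> {0..1} \<Longrightarrow> t \<in> {0..1} \<Longrightarrow> dist (c s) (c t) = dist x y * \<bar>s - t\<bar>"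
  by (simp add: is_geodesic_def)

lemma is_geodesic_ends: "is_geodesic c x y \<Longrightarrow> c 0 = x" "is_geodesic c x y \<Longrightarrow> c 1 = y"
  by (simp_all add: is_geodesic_def)

lemma is_geodesic_dist_start:
  assumes "is_geodesic c x y" "s \<in> {0..1}"
  shows "dist x (c s) = s * dist x y"
  using is_geodesic_dist[OF assms(1), of 0 s] is_geodesic_ends[OF assms(1)] assms(2) by simp

lemma is_geodesic_dist_end:
  assumes "is_geodesic c x y" "s \<in> {0..1}"
  shows "dist y (c s) = (1 - s) * dist x y"
  using is_geodesic_dist[OF assms(1), of 1 s] is_geodesic_ends[OF assms(1)] assms(2) by simp

text \<open>The restriction keeps the reparametrized segment extensional, so that uniqueness of
  geodesics applies to it.\<close>

lemma is_geodesic_initial: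
  assumes c: "is_geodesic c x y" and s: "s \<in> {0..1}"
  shows "is_geodesic (\<lambda>u\<in>{0..1}. c (s * u)) x (c s)"
proof -
  have "dist (c (s * u)) (c (s * v)) = dist x (c s) * \<bar>u - v\<bar>"
    if "u \<in> {0..1}" "v \<in> {0..1}" for u v
  proof -
    have "s * u \<in> {0..1}" "s * v \<in> {0..1}"
      using that s by (auto intro: mult_le_one)
    from is_geodesic_dist[OF c this] show ?thesis
      using s by (simp add: is_geodesic_dist_start[OF c s] abs_mult flip: right_diff_distrib)
  qed
  then show ?thesis
    using is_geodesic_ends[OF c] by (simp add: is_geodesic_def)
qed

text \<open>The law of cosines: for \<open>q\<close> and \<open>r\<close> different from
  \<open>p\<close> this is the cosine of the comparison angle. Monotonicity and limits are proved
  for it and then carried over by \<open>arccos\<close>.\<close>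

definition cos_comparison :: "'a::metric_space \<Rightarrow> 'a \<Rightarrow> 'a \<Rightarrow> real" where
  "cos_comparison p q r = ((dist p q)\<^sup>2 + (dist p r)\<^sup>2 - (dist q r)\<^sup>2) / (2 * dist p q * dist p r)"

lemma cos_comparison_commute: "cos_comparison p q r = cos_comparison p r q"
  by (simp add: cos_comparison_def dist_commute mult_ac add_ac)

lemma cos_comparison_bounds:
  assumes "q \<noteq> p" "r \<noteq> p"
  shows "-1 \<le> cos_comparison p q r" "cos_comparison p q r \<le> 1"
proof -
  have pos: "0 < 2 * dist p q * dist p r" using assms by simp
  have "(dist q r)\<^sup>2 \<le> (dist p q + dist p r)\<^sup>2"
    by (intro power_mono) (metis dist_commute dist_triangle, simp)
  then show "-1 \<le> cos_comparison p q r"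
    unfolding cos_comparison_def using pos
    by (simp add: pos_le_divide_eq power2_eq_square algebra_simps)
  have "\<bar>dist p q - dist p r\<bar> \<le> dist q r"
    by (metis abs_dist_diff_le dist_commute)
  then have "(dist p q - dist p r)\<^sup>2 \<le> (dist q r)\<^sup>2"
    by (metis abs_le_square_iff abs_of_nonneg zero_le_dist)
  then show "cos_comparison p q r \<le> 1"
    unfolding cos_comparison_def using pos
    by (simp add: pos_divide_le_eq power2_eq_square algebra_simps)
qed

text \<open>The law of cosines gives uniqueness of the angle under \<open>THE\<close>, and a
  Euclidean triangle with these sides gives existence.\<close>

lemma comparison_angle_eq_arccos:
  fixes p q r :: "'a::metric_space"
  assumes "q \<noteq> p" "r \<noteq> p"
  shows "comparison_angle p q r = arccos (cos_comparison p q r)"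
proof -
  have angle: "euclidean_angle a b c = arccos (cos_comparison p q r)"
    if "dist a b = dist p q" "dist a c = dist p r" "dist b c = dist q r" for a b c
  proof -
    have "(dist b c)\<^sup>2 = (dist a b)\<^sup>2 + (dist a c)\<^sup>2 - 2 * ((b - a) \<bullet> (c - a))"
      unfolding dist_norm power2_norm_eq_inner by (simp add: algebra_simps inner_commute)
    then have inner: "(b - a) \<bullet> (c - a) = ((dist p q)\<^sup>2 + (dist p r)\<^sup>2 - (dist q r)\<^sup>2) / 2"
      using that by simp
    have norm: "norm (b - a) = dist p q" "norm (c - a) = dist p r"
      using that by (simp_all add: dist_norm norm_minus_commute)
    show ?thesis
      unfolding euclidean_angle_def cos_comparison_def
      by (simp only: inner norm divide_divide_eq_left mult.assoc)
  qed
  obtain a b c :: complex where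
    abc: "dist a b = dist p q" "dist b c = dist q r" "dist a c = dist p r"
    by (rule euclidean_triangle_exists[of "dist p q" "dist q r" "dist p r"])
      (metis dist_commute dist_triangle add.commute)+
  have "(THE \<theta>. \<exists>a b c. dist a b = dist p q \<and> dist a c = dist p r \<and> dist b c = dist q r \<and>
             \<theta> = euclidean_angle a b c) = arccos (cos_comparison p q r)"
  proof (rule the_equality)
    show "\<exists>a b c. dist a b = dist p q \<and> dist a c = dist p r \<and> dist b c = dist q r \<and>
        arccos (cos_comparison p q r) = euclidean_angle a b c"
      using angle abc by metis
  qed (use angle in auto)
  then show ?thesis using assms by (simp add: comparison_angle_def)
qed

lemma at_right_0_eventually_bounds:
  fixes e :: real
  assumes "0 < e"
  shows "\<forall>\<^sub>F s in at_right 0. 0 < s \<and> s < e"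
  using assms eventually_at_right_field by blast

lemma prod_at_right_0_eventually_bounds:
  fixes a b :: real
  assumes "0 < a" "0 < b"
  shows "\<forall>\<^sub>F (s, t) in at_right 0 \<times>\<^sub>F at_right 0. 0 < s \<and> s < a \<and> 0 < t \<and> t < b"
  using eventually_prodI[OF at_right_0_eventually_bounds[OF assms(1)]
      at_right_0_eventually_bounds[OF assms(2)]]
  by (rule eventually_mono) auto

lemma prod_at_right_neq_bot: "at_right (0::real) \<times>\<^sub>F at_right (0::real) \<noteq> bot"
  by (simp add: prod_filter_eq_bot)

text \<open>Along nonzero geodesics the comparison cosine grows as \<open>s\<close> and
  \<open>t\<close> decrease, so this supremum is its limit at 0: the cosine of the Alexandrov
  angle.\<close>

definition cos_angle :: "'a::metric_space \<Rightarrow> (real \<Rightarrow> 'a) \<Rightarrow> (real \<Rightarrow> 'a) \<Rightarrow> real" where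
  "cos_angle p c d = (SUP (s, t) \<in> {0<..1} \<times> {0<..1}. cos_comparison p (c s) (d t))"

text \<open>The limit of this quotient at \<open>0\<close> is twice the sine of half the Alexandrov angle, and unlike
  the angle it satisfies the triangle inequality trivially. So geodesics at angle \<open>0\<close> are
  interchangeable in angles, without the triangle inequality for angles.\<close>

definition chord_ratio :: "(real \<Rightarrow> 'a::metric_space) \<Rightarrow> (real \<Rightarrow> 'a) \<Rightarrow> real \<Rightarrow> real" where
  "chord_ratio c d s = dist (c (s / dist (c 0) (c 1))) (d (s / dist (d 0) (d 1))) / s"

lemma chord_ratio_commute: "chord_ratio c d = chord_ratio d c"
  by (rule ext) (simp add: chord_ratio_def dist_commute)

section \<open>CAT(0) inequalities\<close>

context
  assumes cat0: "CAT0 TYPE('a::metric_space)"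
begin

lemma geodesic_exists: "\<exists>c. is_geodesic c x (y :: 'a)"
  using cat0 unfolding CAT0_def by blast

text \<open>Comparison of a vertex with a point of the opposite side;
  \<open>dist_convex_combination\<close> evaluates the Euclidean distance exactly. Every later use
  of the CAT(0) condition passes through this inequality or the existence of geodesics.\<close>

lemma CN_inequality:
  fixes x y z :: 'a
  assumes c: "is_geodesic c x y" and t: "t \<in> {0..1}"
  shows "(dist z (c t))\<^sup>2 \<le> (1 - t) * (dist z x)\<^sup>2 + t * (dist z y)\<^sup>2 - t * (1 - t) * (dist x y)\<^sup>2"
proof -
  obtain d e where d: "is_geodesic d y z" and e: "is_geodesic e z x"
    using geodesic_exists by metis
  obtain p q r :: complex where w: "dist p q = dist x y" "dist q r = dist y z" "dist p r = dist x z"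
    by (rule euclidean_triangle_exists[of "dist x y" "dist y z" "dist x z"])
      (metis dist_commute dist_triangle add.commute)+
  define V where "V i = (if i = 0 then x else if i = 1 then y else z)" for i :: nat
  define C where "C i = (if i = 0 then c else if i = 1 then d else e)" for i :: nat
  define W where "W i = (if i = 0 then p else if i = 1 then q else r)" for i :: nat
  have less3: "i < 3 \<longleftrightarrow> i = 0 \<or> i = 1 \<or> i = 2" for i :: nat by auto
  have "geodesic_triangle V C"
    unfolding geodesic_triangle_def using c d e by (auto simp: less3 V_def C_def)
  moreover have "comparison_triangle V W"
    unfolding comparison_triangle_def using w by (auto simp: less3 V_def W_def dist_commute)
  \<comment> \<open>Side 2 starts at the third vertex, so its point at parameter 0 is
    \<open>z\<close>.\<close>
  ultimately have "dist (C 0 t) (C 2 0) \<le> dist (comparison_point W 0 t) (comparison_point W 2 0)"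
    using cat0 t unfolding CAT0_def by (auto simp: less3)
  then have "dist z (c t) \<le> dist ((1 - t) *\<^sub>R p + t *\<^sub>R q) r"
    using is_geodesic_ends[OF e] by (simp add: C_def W_def comparison_point_def dist_commute)
  then have "(dist z (c t))\<^sup>2 \<le> (dist ((1 - t) *\<^sub>R p + t *\<^sub>R q) r)\<^sup>2"
    by (rule power_mono) simp
  then show ?thesis
    unfolding dist_convex_combination using w by (simp add: dist_commute)
qed

text \<open>Taking \<open>d t\<close> for \<open>z\<close> in the CN inequality makes its right-hand
  side vanish.\<close>

lemma geodesic_unique:
  fixes x y :: 'a
  assumes c: "is_geodesic c x y" and d: "is_geodesic d x y"
  shows "c = d"
proof (rule extensionalityI)
  show "c \<in> extensional {0..1}" "d \<in> extensional {0..1}"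
    using assms by (simp_all add: is_geodesic_def)
  fix t :: real assume t: "t \<in> {0..1}"
  have "(dist (d t) (c t))\<^sup>2 \<le> (1 - t) * (t * dist x y)\<^sup>2 + t * ((1 - t) * dist x y)\<^sup>2
      - t * (1 - t) * (dist x y)\<^sup>2"
    using CN_inequality[OF c t, of "d t"]
    by (simp add: dist_commute is_geodesic_dist_start[OF d t] is_geodesic_dist_end[OF d t])
  also have "\<dots> = 0" by (simp add: power2_eq_square algebra_simps)
  finally show "c t = d t" by simp
qed

lemma is_geodesic_geod: "is_geodesic (geod x y) x (y :: 'a)"
proof -
  obtain c where c: "is_geodesic c x y" using geodesic_exists by blast
  show ?thesis
    unfolding geod_def
    by (rule theI[of "\<lambda>c. is_geodesic c x y", OF c]) (rule geodesic_unique[OF _ c])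
qed

lemma geod_eqI: "is_geodesic c x (y :: 'a) \<Longrightarrow> geod x y = c"
  by (rule geodesic_unique[OF is_geodesic_geod])

text \<open>Replacing \<open>dist x y\<close> in the CN inequality by the smaller
  \<open>\<bar>dist z x - dist z y\<bar>\<close> turns the right-hand side into a perfect
  square.\<close>

lemma dist_geod_convex:
  fixes x y z :: 'a
  assumes t: "t \<in> {0..1}"
  shows "dist z (geod x y t) \<le> (1 - t) * dist z x + t * dist z y"
proof (rule power2_le_imp_le)
  have "\<bar>dist z x - dist z y\<bar> \<le> dist x y"
    by (metis abs_dist_diff_le dist_commute)
  then have "(dist z x - dist z y)\<^sup>2 \<le> (dist x y)\<^sup>2"
    by (metis abs_le_square_iff abs_of_nonneg zero_le_dist)
  then have "t * (1 - t) * (dist z x - dist z y)\<^sup>2 \<le> t * (1 - t) * (dist x y)\<^sup>2"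
    using t by (intro mult_left_mono) auto
  with CN_inequality[OF is_geodesic_geod t, of z x y]
  have "(dist z (geod x y t))\<^sup>2 \<le> (1 - t) * (dist z x)\<^sup>2 + t * (dist z y)\<^sup>2
      - t * (1 - t) * (dist z x - dist z y)\<^sup>2"
    by linarith
  also have "\<dots> = ((1 - t) * dist z x + t * dist z y)\<^sup>2"
    by (simp add: power2_eq_square algebra_simps)
  finally show "(dist z (geod x y t))\<^sup>2 \<le> ((1 - t) * dist z x + t * dist z y)\<^sup>2" .
qed (use t in auto)

text \<open>The diagonal \<open>x w\<close> is divided in the ratio \<open>dist x y : dist z w\<close>; the other diagonal is
  bounded through the dividing point.\<close>

lemma quadrilateral_inequality:
  fixes x y z w :: 'a
  shows "(dist x w)\<^sup>2 + (dist y z)\<^sup>2 \<le> (dist x z)\<^sup>2 + (dist y w)\<^sup>2 + 2 * dist x y * dist z w"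
proof (cases "x = y \<or> z = w")
  case False
  define a b where "a = dist x y" and "b = dist z w"
  have pos: "0 < a" "0 < b" using False by (auto simp: a_def b_def)
  define t where "t = a / (a + b)"
  have t: "0 < t" "t < 1" "t \<in> {0..1}" using pos by (auto simp: t_def)
  \<comment> \<open>With this balance \<open>((1 - t) * a)^2 + (t * b)^2\<close> equals twice the
    product of its bases, which yields the sharp term \<open>2 * a * b\<close>.\<close>
  have tab: "(1 - t) * a = t * b" using pos by (simp add: t_def field_simps)
  define m where "m = geod x w t"
  define P where "P = dist y m"
  define Q where "Q = dist z m"
  have P: "P\<^sup>2 \<le> (1 - t) * a\<^sup>2 + t * (dist y w)\<^sup>2 - t * (1 - t) * (dist x w)\<^sup>2"
    using CN_inequality[OF is_geodesic_geod t(3), of y x w] by (simp add: P_def m_def a_def dist_commute)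
  have Q: "Q\<^sup>2 \<le> (1 - t) * (dist x z)\<^sup>2 + t * b\<^sup>2 - t * (1 - t) * (dist x w)\<^sup>2"
    using CN_inequality[OF is_geodesic_geod t(3), of z x w] by (simp add: Q_def m_def b_def dist_commute)
  have "dist y z \<le> P + Q" unfolding P_def Q_def by (metis dist_commute dist_triangle)
  then have "(dist y z)\<^sup>2 \<le> (P + Q)\<^sup>2" by (intro power_mono) auto
  then have "t * (1 - t) * (dist y z)\<^sup>2 \<le> t * (1 - t) * (P + Q)\<^sup>2"
    using t by (intro mult_left_mono) auto
  \<comment> \<open>A weighted Cauchy-Schwarz inequality, with the square to be discarded made
    explicit.\<close>
  also have "\<dots> = (1 - t) * P\<^sup>2 + t * Q\<^sup>2 - ((1 - t) * P - t * Q)\<^sup>2"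
    by (simp add: power2_eq_square algebra_simps)
  also have "\<dots> \<le> (1 - t) * P\<^sup>2 + t * Q\<^sup>2" by simp
  also have "\<dots> \<le> (1 - t) * ((1 - t) * a\<^sup>2 + t * (dist y w)\<^sup>2 - t * (1 - t) * (dist x w)\<^sup>2)
      + t * ((1 - t) * (dist x z)\<^sup>2 + t * b\<^sup>2 - t * (1 - t) * (dist x w)\<^sup>2)"
    using t by (intro add_mono mult_left_mono P Q) auto
  also have "\<dots> = ((1 - t) * a)\<^sup>2 + (t * b)\<^sup>2
      + t * (1 - t) * ((dist x z)\<^sup>2 + (dist y w)\<^sup>2 - (dist x w)\<^sup>2)"
    by (simp add: power2_eq_square algebra_simps)
  also have "((1 - t) * a)\<^sup>2 + (t * b)\<^sup>2 = t * (1 - t) * (2 * a * b)"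
  proof -
    have "((1 - t) * a)\<^sup>2 + (t * b)\<^sup>2 = 2 * ((1 - t) * a) * (t * b)"
      by (simp add: tab power2_eq_square)
    then show ?thesis by (simp add: mult_ac)
  qed
  also have "t * (1 - t) * (2 * a * b) + t * (1 - t) * ((dist x z)\<^sup>2 + (dist y w)\<^sup>2 - (dist x w)\<^sup>2)
    = t * (1 - t) * ((dist x z)\<^sup>2 + (dist y w)\<^sup>2 - (dist x w)\<^sup>2 + 2 * a * b)"
    by (simp add: algebra_simps)
  finally have "(dist y z)\<^sup>2 \<le> (dist x z)\<^sup>2 + (dist y w)\<^sup>2 - (dist x w)\<^sup>2 + 2 * a * b"
    using t by (simp add: mult_le_cancel_left_pos)
  then show ?thesis by (simp add: a_def b_def)
qed (auto simp: dist_commute)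

section \<open>Alexandrov angles and tangent vectors\<close>

text \<open>The CN inequality on the segment from \<open>p\<close> to \<open>c s\<close>, at
  parameter \<open>k = s' / s\<close>: the numerator shrinks at most by the factor \<open>k\<close>,
  while the denominator shrinks exactly by it.\<close>

lemma cos_comparison_shrink:
  fixes p q r :: 'a
  assumes c: "is_geodesic c p q" and ne: "q \<noteq> p" "r \<noteq> p"
    and s: "s \<in> {0..1}" and s': "0 < s'" "s' \<le> s"
  shows "cos_comparison p (c s) r \<le> cos_comparison p (c s') r"
proof -
  define k where "k = s' / s"
  have k: "0 < k" "k \<in> {0..1}" "s' = s * k" using s s' by (auto simp: k_def)
  have s'01: "s' \<in> {0..1}" using s s' by simp
  have cs: "dist p (c s') = k * dist p (c s)"
    unfolding is_geodesic_dist_start[OF c s'01] is_geodesic_dist_start[OF c s] by (simp add: k(3))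
  have pos: "0 < dist p (c s)" "0 < dist p r"
    using s s' ne by (auto simp: is_geodesic_dist_start[OF c s])
  have "(dist r (c s'))\<^sup>2 \<le> (1 - k) * (dist r p)\<^sup>2 + k * (dist r (c s))\<^sup>2
      - k * (1 - k) * (dist p (c s))\<^sup>2"
    using CN_inequality[OF is_geodesic_initial[OF c s] k(2), of r] k by simp
  then have "k * ((dist p (c s))\<^sup>2 + (dist p r)\<^sup>2 - (dist (c s) r)\<^sup>2)
      \<le> (dist p (c s'))\<^sup>2 + (dist p r)\<^sup>2 - (dist (c s') r)\<^sup>2"
    unfolding cs by (simp add: power2_eq_square algebra_simps dist_commute)
  then have "k * ((dist p (c s))\<^sup>2 + (dist p r)\<^sup>2 - (dist (c s) r)\<^sup>2) / (2 * (k * dist p (c s)) * dist p r)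
      \<le> ((dist p (c s'))\<^sup>2 + (dist p r)\<^sup>2 - (dist (c s') r)\<^sup>2) / (2 * (k * dist p (c s)) * dist p r)"
    using k pos by (intro divide_right_mono) auto
  also have "k * ((dist p (c s))\<^sup>2 + (dist p r)\<^sup>2 - (dist (c s) r)\<^sup>2) / (2 * (k * dist p (c s)) * dist p r)
      = cos_comparison p (c s) r"
    using k by (simp add: cos_comparison_def)
  finally show ?thesis by (simp add: cos_comparison_def cs)
qed

lemma is_geodesic_neq_start:
  "is_geodesic c p q \<Longrightarrow> q \<noteq> p \<Longrightarrow> 0 < s \<Longrightarrow> s \<le> 1 \<Longrightarrow> c s \<noteq> (p :: 'a)"
  using is_geodesic_dist_start[of c p q s] by auto

lemma cos_comparison_antimono:
  fixes p q r :: 'a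
  assumes c: "is_geodesic c p q" and d: "is_geodesic d p r" and ne: "q \<noteq> p" "r \<noteq> p"
    and s: "0 < s'" "s' \<le> s" "s \<le> 1" and t: "0 < t'" "t' \<le> t" "t \<le> 1"
  shows "cos_comparison p (c s) (d t) \<le> cos_comparison p (c s') (d t')"
proof -
  have "c s' \<noteq> p" "d t \<noteq> p"
    using is_geodesic_neq_start[OF c ne(1)] is_geodesic_neq_start[OF d ne(2)] s t by auto
  then have "cos_comparison p (c s) (d t) \<le> cos_comparison p (c s') (d t)"
    "cos_comparison p (d t) (c s') \<le> cos_comparison p (d t') (c s')"
    using s t ne by (auto intro!: cos_comparison_shrink[OF c] cos_comparison_shrink[OF d])
  then show ?thesis by (simp add: cos_comparison_commute)
qed

text \<open>By antimonotonicity, a value close to the supremum at one pair is a lower bound at all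
  smaller pairs, so the supremum is the limit along the product filter.\<close>

lemma
  fixes p q r :: 'a
  assumes c: "is_geodesic c p q" and d: "is_geodesic d p r" and ne: "q \<noteq> p" "r \<noteq> p"
  shows cos_angle_upper: "0 < s \<Longrightarrow> s \<le> 1 \<Longrightarrow> 0 < t \<Longrightarrow> t \<le> 1 \<Longrightarrow>
      cos_comparison p (c s) (d t) \<le> cos_angle p c d"
    and cos_angle_bounds: "-1 \<le> cos_angle p c d" "cos_angle p c d \<le> 1"
    and cos_comparison_tendsto:
      "((\<lambda>(s, t). cos_comparison p (c s) (d t)) \<longlongrightarrow> cos_angle p c d) (at_right 0 \<times>\<^sub>F at_right 0)"
    and alexandrov_angle_eq_arccos: "alexandrov_angle p c d = arccos (cos_angle p c d)"
proof -
  let ?I = "{0<..1::real} \<times> {0<..1::real}"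
  let ?G = "\<lambda>(s, t). cos_comparison p (c s) (d t)"
  let ?F = "at_right (0::real) \<times>\<^sub>F at_right (0::real)"
  have neq: "c s \<noteq> p" "d s \<noteq> p" if "0 < s" "s \<le> 1" for s
    using is_geodesic_neq_start[OF c ne(1) that] is_geodesic_neq_start[OF d ne(2) that] .
  have bounds: "-1 \<le> cos_comparison p (c s) (d t)" "cos_comparison p (c s) (d t) \<le> 1"
    if "0 < s" "s \<le> 1" "0 < t" "t \<le> 1" for s t
    using cos_comparison_bounds[OF neq(1) neq(2)] that by blast+
  have bdd: "bdd_above (?G ` ?I)"
    by (rule bdd_aboveI[of _ 1]) (use bounds in auto)
  show upper: "cos_comparison p (c s) (d t) \<le> cos_angle p c d"
    if "0 < s" "s \<le> 1" "0 < t" "t \<le> 1" for s t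
    using cSUP_upper[OF _ bdd, of "(s, t)"] that by (simp add: cos_angle_def)
  show bd: "-1 \<le> cos_angle p c d" "cos_angle p c d \<le> 1"
    using bounds(1)[of 1 1] upper[of 1 1] apply simp
    unfolding cos_angle_def by (rule cSUP_least) (use bounds in auto)
  show lim: "(?G \<longlongrightarrow> cos_angle p c d) ?F"
  proof (rule order_tendstoI)
    fix a assume "a < cos_angle p c d"
    then obtain s t where st: "0 < s" "s \<le> 1" "0 < t" "t \<le> 1" "a < cos_comparison p (c s) (d t)"
      unfolding cos_angle_def using less_cSUP_iff[OF _ bdd, of a] by auto
    show "\<forall>\<^sub>F x in ?F. a < ?G x"
      using prod_at_right_0_eventually_bounds[OF st(1) st(3)]
    proof eventually_elim
      case (elim x)
      then show ?case
        using cos_comparison_antimono[OF c d ne, of "fst x" s "snd x" t] st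
        by (auto simp: case_prod_beta)
    qed
  next
    fix a assume a: "cos_angle p c d < a"
    show "\<forall>\<^sub>F x in ?F. ?G x < a"
      using prod_at_right_0_eventually_bounds[OF zero_less_one zero_less_one]
    proof eventually_elim
      case (elim x)
      then show ?case using upper[of "fst x" "snd x"] a by (auto simp: case_prod_beta)
    qed
  qed
  have "\<forall>\<^sub>F x in ?F. ?G x \<in> {-1..1} \<and> arccos (?G x) = (\<lambda>(s, t). comparison_angle p (c s) (d t)) x"
    using prod_at_right_0_eventually_bounds[OF zero_less_one zero_less_one]
  proof eventually_elim
    case (elim x)
    then have "c (fst x) \<noteq> p" "d (snd x) \<noteq> p"
      using neq(1)[of "fst x"] neq(2)[of "snd x"] by (auto simp: case_prod_beta)
    then show ?case
      using cos_comparison_bounds[of "c (fst x)" p "d (snd x)"]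
      by (simp add: comparison_angle_eq_arccos case_prod_beta)
  qed
  then have ev2: "\<forall>\<^sub>F x in ?F. ?G x \<in> {-1..1}"
    "\<forall>\<^sub>F x in ?F. arccos (?G x) = (\<lambda>(s, t). comparison_angle p (c s) (d t)) x"
    by (simp_all add: eventually_conj_iff)
  \<comment> \<open>Continuity of \<open>arccos\<close> is available on the interval from -1 to 1
    only, hence the first part of \<open>ev2\<close>.\<close>
  have "((\<lambda>x. arccos (?G x)) \<longlongrightarrow> arccos (cos_angle p c d)) ?F"
    by (rule continuous_on_tendsto_compose[OF continuous_on_arccos' lim _ ev2(1)]) (use bd in auto)
  then have "((\<lambda>(s, t). comparison_angle p (c s) (d t)) \<longlongrightarrow> arccos (cos_angle p c d)) ?F"
    using filterlim_cong[OF refl refl ev2(2)] by blast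
  then show "alexandrov_angle p c d = arccos (cos_angle p c d)"
    unfolding alexandrov_angle_def by (rule tendsto_Lim[OF prod_at_right_neq_bot])
qed


text \<open>Dividing by the lengths puts both points at distance \<open>s\<close> from
  \<open>p\<close>. In such an isosceles triangle the squared ratio of base to leg is 2 minus twice
  the cosine at \<open>p\<close>.\<close>

lemma chord_ratio_tendsto:
  fixes p :: 'a
  assumes c: "is_geodesic c p q" and d: "is_geodesic d p r" and ne: "q \<noteq> p" "r \<noteq> p"
  shows "(chord_ratio c d \<longlongrightarrow> sqrt (2 - 2 * cos_angle p c d)) (at_right 0)"
proof -
  define l where "l = dist p q"
  define m where "m = dist p r"
  have pos: "0 < l" "0 < m" using ne by (auto simp: l_def m_def)
  have "filterlim (\<lambda>s. s / a) (at_right 0) (at_right 0)" if "0 < a" for a :: real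
  proof (rule tendsto_imp_filterlim_at_right)
    show "((\<lambda>s. s / a) \<longlongrightarrow> 0) (at_right 0)"
      using tendsto_divide[OF tendsto_ident_at tendsto_const, of a 0 "{0<..}"] that by simp
    show "\<forall>\<^sub>F s in at_right 0. 0 < s / a"
      using at_right_0_eventually_bounds[OF zero_less_one] by eventually_elim (use that in simp)
  qed
  then have "filterlim (\<lambda>s. (s / l, s / m)) (at_right 0 \<times>\<^sub>F at_right 0) (at_right 0)"
    using pos by (intro filterlim_Pair) auto
  from filterlim_compose[OF cos_comparison_tendsto[OF assms] this]
  have "((\<lambda>s. cos_comparison p (c (s / l)) (d (s / m))) \<longlongrightarrow> cos_angle p c d) (at_right 0)"
    by simp
  then have lim: "((\<lambda>s. sqrt (2 - 2 * cos_comparison p (c (s / l)) (d (s / m))))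
      \<longlongrightarrow> sqrt (2 - 2 * cos_angle p c d)) (at_right 0)"
    by (intro tendsto_intros)
  have "\<forall>\<^sub>F s in at_right 0. sqrt (2 - 2 * cos_comparison p (c (s / l)) (d (s / m))) = chord_ratio c d s"
    using at_right_0_eventually_bounds[OF pos(1)] at_right_0_eventually_bounds[OF pos(2)]
  proof eventually_elim
    case (elim s)
    then have "s / l \<in> {0..1}" "s / m \<in> {0..1}" using pos by auto
    then have ds: "dist p (c (s / l)) = s" "dist p (d (s / m)) = s"
      using is_geodesic_dist_start[OF c] is_geodesic_dist_start[OF d] pos
      by (auto simp: l_def m_def)
    have "2 - 2 * cos_comparison p (c (s / l)) (d (s / m)) = (dist (c (s / l)) (d (s / m)) / s)\<^sup>2"
      using elim unfolding cos_comparison_def ds by (simp add: field_simps power2_eq_square)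
    then show ?case
      using elim is_geodesic_ends[OF c] is_geodesic_ends[OF d]
      by (simp add: chord_ratio_def l_def m_def)
  qed
  from filterlim_cong[OF refl refl this] lim show ?thesis by blast
qed

text \<open>Limits are unique and the square root is injective, so symmetry and congruence of angles
  can be checked on chord ratios.\<close>

lemma cos_angle_eqI:
  fixes p :: 'a
  assumes c: "is_geodesic c p q" "q \<noteq> p" and d: "is_geodesic d p r" "r \<noteq> p"
    and lim: "(chord_ratio c d \<longlongrightarrow> sqrt (2 - 2 * k)) (at_right 0)"
  shows "cos_angle p c d = k"
  using tendsto_unique[OF _ chord_ratio_tendsto[OF c(1) d(1) c(2) d(2)] lim] by simp

lemma alexandrov_angle_commute_nonzero:
  fixes p :: 'a
  assumes c: "is_geodesic c p q" "q \<noteq> p" and d: "is_geodesic d p r" "r \<noteq> p"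
  shows "alexandrov_angle p c d = alexandrov_angle p d c"
proof -
  have "cos_angle p c d = cos_angle p d c"
    by (rule cos_angle_eqI[OF c d])
      (use chord_ratio_tendsto[OF d(1) c(1) d(2) c(2)] in \<open>simp add: chord_ratio_commute\<close>)
  then show ?thesis
    by (simp add: alexandrov_angle_eq_arccos[OF c(1) d(1) c(2) d(2)]
        alexandrov_angle_eq_arccos[OF d(1) c(1) d(2) c(2)])
qed

lemma alexandrov_angle_eq_0_iff:
  fixes p :: 'a
  assumes c: "is_geodesic c p q" "q \<noteq> p" and d: "is_geodesic d p r" "r \<noteq> p"
  shows "alexandrov_angle p c d = 0 \<longleftrightarrow> (chord_ratio c d \<longlongrightarrow> 0) (at_right 0)"
proof -
  note cd = c(1) d(1) c(2) d(2)
  have "alexandrov_angle p c d = 0 \<longleftrightarrow> cos_angle p c d = 1"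
    unfolding alexandrov_angle_eq_arccos[OF cd] by (intro arccos_0_iff cos_angle_bounds[OF cd])
  also have "\<dots> \<longleftrightarrow> (chord_ratio c d \<longlongrightarrow> 0) (at_right 0)"
    using chord_ratio_tendsto[OF cd] cos_angle_eqI[OF c d, of 1] by auto
  finally show ?thesis .
qed

text \<open>By the triangle inequality at equal distance from \<open>p\<close>, the chord ratios of
  \<open>c\<close> and \<open>c'\<close> against \<open>d\<close> differ by at most
  \<open>chord_ratio c c'\<close>, which tends to 0.\<close>

lemma alexandrov_angle_cong_nonzero:
  fixes p :: 'a
  assumes c: "is_geodesic c p q" "q \<noteq> p" and c': "is_geodesic c' p q'" "q' \<noteq> p"
    and d: "is_geodesic d p r" "r \<noteq> p" and "alexandrov_angle p c c' = 0"
  shows "alexandrov_angle p c d = alexandrov_angle p c' d"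
proof -
  have 0: "(chord_ratio c c' \<longlongrightarrow> 0) (at_right 0)"
    using assms alexandrov_angle_eq_0_iff[OF c c'] by simp
  have "((\<lambda>s. chord_ratio c' d s - chord_ratio c d s) \<longlongrightarrow> 0) (at_right 0)"
  proof (rule Lim_null_comparison[OF _ 0])
    show "\<forall>\<^sub>F s in at_right 0. norm (chord_ratio c' d s - chord_ratio c d s) \<le> chord_ratio c c' s"
      using at_right_0_eventually_bounds[OF zero_less_one]
    proof eventually_elim
      case (elim s)
      have tri: "\<bar>dist a e - dist b e\<bar> \<le> dist b a" for a b e :: 'a
        by (metis abs_dist_diff_le dist_commute)
      have "norm (chord_ratio c' d s - chord_ratio c d s)
        = \<bar>dist (c' (s / dist (c' 0) (c' 1))) (d (s / dist (d 0) (d 1)))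
          - dist (c (s / dist (c 0) (c 1))) (d (s / dist (d 0) (d 1)))\<bar> / s"
        using elim by (simp add: chord_ratio_def flip: diff_divide_distrib)
      also have "\<dots> \<le> chord_ratio c c' s"
        unfolding chord_ratio_def using elim by (intro divide_right_mono tri) auto
      finally show ?case .
    qed
  qed
  from tendsto_add[OF this chord_ratio_tendsto[OF c(1) d(1) c(2) d(2)]]
  have "cos_angle p c' d = cos_angle p c d"
    by (intro cos_angle_eqI[OF c' d]) simp
  then show ?thesis
    by (simp add: alexandrov_angle_eq_arccos[OF c(1) d(1) c(2) d(2)]
        alexandrov_angle_eq_arccos[OF c'(1) d(1) c'(2) d(2)])
qed

section \<open>Zero geodesics and directions as equivalence classes\<close>

lemma geodesics_fromD: "c \<in> geodesics_from (p :: 'a) \<Longrightarrow> is_geodesic c p (c 1)"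
  by (auto simp: geodesics_from_def is_geodesic_def)

lemma zeta_eq: "c \<in> geodesics_from (p :: 'a) \<Longrightarrow> zeta c = (if c 1 = p then 0 else 1)"
  using is_geodesic_ends(1)[OF geodesics_fromD, of c p] by (auto simp: zeta_def)

text \<open>A zero geodesic stays at \<open>p\<close> and a nonzero one leaves it at once, so on
  small positive parameters the comparison angle has a constant value, fixed by convention.\<close>

lemma alexandrov_angle_degenerate:
  fixes p :: 'a
  assumes c: "c \<in> geodesics_from p" and d: "d \<in> geodesics_from p" and z: "zeta c = 0 \<or> zeta d = 0"
  shows "alexandrov_angle p c d = (if zeta c = zeta d then 0 else pi / 2)"
proof -
  have at: "b s = p \<longleftrightarrow> zeta b = 0" if "b \<in> geodesics_from p" "0 < s" "s < 1" for b s
    using is_geodesic_dist_start[OF geodesics_fromD[OF that(1)], of s] that(2,3)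
    by (auto simp: zeta_eq[OF that(1)])
  have "\<forall>\<^sub>F x in at_right 0 \<times>\<^sub>F at_right 0. (\<lambda>(s, t). comparison_angle p (c s) (d t)) x
      = (if zeta c = zeta d then 0 else pi / 2)"
    using prod_at_right_0_eventually_bounds[OF zero_less_one zero_less_one]
  proof eventually_elim
    case (elim x)
    then show ?case
      using z at[OF c, of "fst x"] at[OF d, of "snd x"]
      by (auto simp: comparison_angle_def case_prod_beta)
  qed
  then show ?thesis
    unfolding alexandrov_angle_def by (intro tendsto_Lim[OF prod_at_right_neq_bot] tendsto_eventually)
qed

lemma alexandrov_angle_commute:
  fixes p :: 'a
  assumes "c \<in> geodesics_from p" "d \<in> geodesics_from p"
  shows "alexandrov_angle p c d = alexandrov_angle p d c"
proof (cases "zeta c = 0 \<or> zeta d = 0")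
  case True
  then show ?thesis
    using alexandrov_angle_degenerate[of c p d] alexandrov_angle_degenerate[of d p c] assms by auto
next
  case False
  then show ?thesis
    using alexandrov_angle_commute_nonzero[OF geodesics_fromD[OF assms(1)] _ geodesics_fromD[OF assms(2)]]
    by (auto simp: zeta_eq[OF assms(1)] zeta_eq[OF assms(2)] split: if_splits)
qed

text \<open>A zero and a nonzero geodesic are at angle \<open>pi / 2\<close>. Hence
  \<open>zeta\<close> is well defined on directions.\<close>

lemma alexandrov_angle_0_zeta:
  fixes p :: 'a
  assumes "c \<in> geodesics_from p" "d \<in> geodesics_from p" "alexandrov_angle p c d = 0"
  shows "zeta c = zeta d"
  using alexandrov_angle_degenerate[OF assms(1,2)] assms(3)
  by (auto simp: zeta_def split: if_splits)

lemma alexandrov_angle_refl: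
  fixes p :: 'a
  assumes c: "c \<in> geodesics_from p"
  shows "alexandrov_angle p c c = 0"
proof (cases "zeta c = 0")
  case True
  then show ?thesis using alexandrov_angle_degenerate[OF c c] by simp
next
  case False
  have "chord_ratio c c = (\<lambda>s. 0)" by (rule ext) (simp add: chord_ratio_def)
  then show ?thesis
    using alexandrov_angle_eq_0_iff[OF geodesics_fromD[OF c] _ geodesics_fromD[OF c]] False
    by (simp add: zeta_eq[OF c] split: if_splits)
qed

text \<open>This yields both transitivity of \<open>direction_rel\<close> and independence of
  \<open>direction_angle\<close> from the representatives. Against a zero geodesic the angle depends
  on \<open>zeta\<close> alone.\<close>

lemma alexandrov_angle_cong:
  fixes p :: 'a
  assumes c: "c \<in> geodesics_from p" and c': "c' \<in> geodesics_from p" and d: "d \<in> geodesics_from p"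
    and 0: "alexandrov_angle p c c' = 0"
  shows "alexandrov_angle p c d = alexandrov_angle p c' d"
proof -
  have z: "zeta c' = zeta c" using alexandrov_angle_0_zeta[OF c c' 0] by simp
  show ?thesis
  proof (cases "zeta c = 0 \<or> zeta d = 0")
    case True
    then show ?thesis
      by (simp only: alexandrov_angle_degenerate[OF c d] alexandrov_angle_degenerate[OF c' d] z)
  next
    case False
    then have "c 1 \<noteq> p" "c' 1 \<noteq> p" "d 1 \<noteq> p"
      using z zeta_eq[OF c] zeta_eq[OF c'] zeta_eq[OF d] by metis+
    then show ?thesis
      by (rule alexandrov_angle_cong_nonzero[OF geodesics_fromD[OF c] _ geodesics_fromD[OF c'] _
          geodesics_fromD[OF d] _ 0])
  qed
qed

lemma equiv_direction_rel: "equiv (geodesics_from p) (direction_rel (p :: 'a))"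
proof (rule equivI)
  have rel: "(c, d) \<in> direction_rel p \<longleftrightarrow>
      c \<in> geodesics_from p \<and> d \<in> geodesics_from p \<and> alexandrov_angle p c d = 0" for c d
    by (simp add: direction_rel_def)
  show "direction_rel p \<subseteq> geodesics_from p \<times> geodesics_from p"
    using rel by auto
  show "refl_on (geodesics_from p) (direction_rel p)"
    by (rule refl_onI) (simp add: rel alexandrov_angle_refl)
  show "sym (direction_rel p)"
  proof (rule symI)
    show "(d, c) \<in> direction_rel p" if "(c, d) \<in> direction_rel p" for c d
      using that alexandrov_angle_commute[of c p d] by (simp add: rel)
  qed
  show "trans (direction_rel p)"
  proof (rule transI)
    show "(c, e) \<in> direction_rel p" if "(c, d) \<in> direction_rel p" "(d, e) \<in> direction_rel p" for c d e
      using that alexandrov_angle_cong[of c p d e] by (simp add: rel)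
  qed
qed

lemma direction_eqI:
  "c \<in> geodesics_from p \<Longrightarrow> d \<in> geodesics_from p \<Longrightarrow> alexandrov_angle p c d = 0 \<Longrightarrow>
    direction p c = direction (p :: 'a) d"
  unfolding direction_def by (rule equiv_class_eq[OF equiv_direction_rel]) (simp add: direction_rel_def)

lemma direction_self: "c \<in> geodesics_from p \<Longrightarrow> c \<in> direction (p :: 'a) c"
  unfolding direction_def by (rule equiv_class_self[OF equiv_direction_rel])

lemma directionD:
  "d \<in> direction p c \<Longrightarrow> c \<in> geodesics_from p \<and> d \<in> geodesics_from p \<and> alexandrov_angle (p :: 'a) c d = 0"
  by (auto simp: direction_def direction_rel_def)

lemma direction_zeta_direction:
  fixes p :: 'a
  assumes "c \<in> geodesics_from p"
  shows "direction_zeta (direction p c) = zeta c"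
  unfolding direction_zeta_def
proof (rule the_elem_image_unique)
  show "direction p c \<noteq> {}" using direction_self[OF assms] by blast
  show "zeta d = zeta c" if "d \<in> direction p c" for d
    using directionD[OF that] alexandrov_angle_0_zeta[of c p d] by simp
qed

lemma direction_angle_direction:
  fixes p :: 'a
  assumes c: "c \<in> geodesics_from p" and d: "d \<in> geodesics_from p"
  shows "direction_angle p (direction p c) (direction p d) = alexandrov_angle p c d"
proof -
  have "alexandrov_angle p c' d' = alexandrov_angle p c d"
    if "c' \<in> direction p c" "d' \<in> direction p d" for c' d'
    using that[THEN directionD] alexandrov_angle_cong[of c p c' d'] alexandrov_angle_cong[of d p d' c]
      alexandrov_angle_commute[of c p d] alexandrov_angle_commute[of c p d'] by simp
  then have "{alexandrov_angle p c' d' | c' d'. c' \<in> direction p c \<and> d' \<in> direction p d}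
      = {alexandrov_angle p c d}"
    using direction_self c d by blast
  then show ?thesis by (simp add: direction_angle_def)
qed

lemma direction_in_space: "c \<in> geodesics_from p \<Longrightarrow> direction p c \<in> direction_space (p :: 'a)"
  by (simp add: direction_def direction_space_def quotientI)

section \<open>Tangent vectors and their inner product\<close>

lemma tangent_vector_self:
  fixes p :: 'a
  assumes "c \<in> geodesics_from p" "0 \<le> t"
  shows "(t, direction p c) \<in> tangent_vector p t c"
  using assms
  by (auto simp: tangent_vector_def tangent_rel_def direction_in_space direction_zeta_direction zeta_def)

text \<open>The zero vector has representatives of every direction, so the direction is recovered
  only away from it. This suffices for the inner product, which vanishes there.\<close>

lemma tangent_vectorD:
  fixes p :: 'a
  assumes "c \<in> geodesics_from p" "(s, X) \<in> tangent_vector p t c"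
  shows "s * direction_zeta X = t * zeta c" "t * zeta c \<noteq> 0 \<Longrightarrow> X = direction p c"
  using assms by (auto simp: tangent_vector_def tangent_rel_def direction_zeta_direction)

lemma tangent_inner_tangent_vector:
  fixes p :: 'a
  assumes c: "c \<in> geodesics_from p" and d: "d \<in> geodesics_from p" and t: "0 \<le> t" "0 \<le> s"
  shows "tangent_inner p (tangent_vector p t c) (tangent_vector p s d)
    = t * s * zeta c * zeta d * cos (alexandrov_angle p c d)"
proof -
  have val: "t1 * t2 * direction_zeta X1 * direction_zeta X2 * cos (direction_angle p X1 X2)
      = t * s * zeta c * zeta d * cos (alexandrov_angle p c d)"
    if 1: "(t1, X1) \<in> tangent_vector p t c" and 2: "(t2, X2) \<in> tangent_vector p s d" for t1 X1 t2 X2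
  proof -
    have "t1 * t2 * direction_zeta X1 * direction_zeta X2 * cos (direction_angle p X1 X2)
        = (t * zeta c) * (s * zeta d) * cos (direction_angle p X1 X2)"
      unfolding tangent_vectorD(1)[OF c 1, symmetric] tangent_vectorD(1)[OF d 2, symmetric]
      by (simp add: mult_ac)
    also have "\<dots> = (t * zeta c) * (s * zeta d) * cos (alexandrov_angle p c d)"
    proof (cases "t * zeta c = 0 \<or> s * zeta d = 0")
      case False
      then show ?thesis
        using tangent_vectorD(2)[OF c 1] tangent_vectorD(2)[OF d 2]
        by (simp add: direction_angle_direction[OF c d])
    qed auto
    finally show ?thesis by (simp add: mult_ac)
  qed
  have "{t1 * t2 * direction_zeta X1 * direction_zeta X2 * cos (direction_angle p X1 X2) |
      t1 X1 t2 X2. (t1, X1) \<in> tangent_vector p t c \<and> (t2, X2) \<in> tangent_vector p s d}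
    = {t * s * zeta c * zeta d * cos (alexandrov_angle p c d)}" (is "?L = {?v}")
  proof (intro equalityI subsetI)
    fix v assume "v \<in> {?v}"
    then show "v \<in> ?L"
      using val[OF tangent_vector_self[OF c t(1)] tangent_vector_self[OF d t(2)]]
        tangent_vector_self[OF c t(1)] tangent_vector_self[OF d t(2)] by force
  qed (use val in auto)
  then show ?thesis by (simp add: tangent_inner_def)
qed

lemma geod_in_geodesics_from: "geod p q \<in> geodesics_from (p :: 'a)"
  using is_geodesic_geod by (auto simp: geodesics_from_def)

lemma zeta_geod: "zeta (geod p q) = (if p = (q :: 'a) then 0 else 1)"
  using is_geodesic_ends[OF is_geodesic_geod] by (simp add: zeta_def)

text \<open>The supremum defining \<open>cos_angle\<close> dominates its term at
  \<open>s = t = 1\<close>, the comparison cosine of the endpoints. Multiplying by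
  \<open>dist p w\<close> clears denominators; both sides vanish in the degenerate cases.\<close>

lemma tangent_inner_geod_ge:
  fixes p x w :: 'a
  assumes t: "0 \<le> t"
  shows "t * ((dist p x)\<^sup>2 + (dist p w)\<^sup>2 - (dist x w)\<^sup>2) / 2
    \<le> tangent_inner p (tangent_vector p (t * dist p x) (geod p x)) (tangent_vector p 1 (geod p w)) * dist p w"
proof -
  have eq: "tangent_inner p (tangent_vector p (t * dist p x) (geod p x)) (tangent_vector p 1 (geod p w))
      = t * dist p x * zeta (geod p x) * zeta (geod p w) * cos (alexandrov_angle p (geod p x) (geod p w))"
    using tangent_inner_tangent_vector[OF geod_in_geodesics_from geod_in_geodesics_from, of "t * dist p x" 1] t
    by simp
  show ?thesis
  proof (cases "p = x \<or> p = w")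
    case True
    then show ?thesis unfolding eq by (auto simp: zeta_geod dist_commute)
  next
    case False
    then have ne: "x \<noteq> p" "w \<noteq> p" by auto
    note cd = is_geodesic_geod[of p x] is_geodesic_geod[of p w] ne
    have "cos (alexandrov_angle p (geod p x) (geod p w)) = cos_angle p (geod p x) (geod p w)"
      using cos_angle_bounds[OF cd] by (simp add: alexandrov_angle_eq_arccos[OF cd] cos_arccos)
    moreover have "cos_comparison p x w \<le> cos_angle p (geod p x) (geod p w)"
      using cos_angle_upper[OF cd, of 1 1] is_geodesic_ends(2)[OF cd(1)] is_geodesic_ends(2)[OF cd(2)]
      by simp
    ultimately have "t * dist p x * cos_comparison p x w * dist p w
        \<le> t * dist p x * cos (alexandrov_angle p (geod p x) (geod p w)) * dist p w"
      using t by (intro mult_right_mono mult_left_mono) auto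
    moreover have "t * dist p x * cos_comparison p x w * dist p w
        = t * ((dist p x)\<^sup>2 + (dist p w)\<^sup>2 - (dist x w)\<^sup>2) / 2"
      using ne by (simp add: cos_comparison_def)
    ultimately show ?thesis
      unfolding eq using ne by (auto simp: zeta_geod)
  qed
qed

text \<open>At equal small distance from \<open>z\<close> the two geodesics pass through the same
  point, so their chord ratio is eventually 0 and their directions agree. The factor
  \<open>u\<close> in the length cancels the one in \<open>inverse (u * l)\<close>.\<close>

lemma tangent_vector_geod_initial:
  fixes z x :: 'a
  assumes u: "0 < u" "u \<le> 1"
  shows "tangent_vector z (inverse (u * l) * dist z (geod z x u)) (geod z (geod z x u))
    = tangent_vector z (inverse l * dist z x) (geod z x)"
proof -
  define y where "y = geod z x u"
  have u01: "u \<in> {0..1}" using u by simp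
  have y: "geod z y = (\<lambda>s\<in>{0..1}. geod z x (u * s))"
    unfolding y_def by (rule geod_eqI[OF is_geodesic_initial[OF is_geodesic_geod u01]])
  have dy: "dist z y = u * dist z x"
    unfolding y_def by (rule is_geodesic_dist_start[OF is_geodesic_geod u01])
  have "direction z (geod z y) = direction z (geod z x)"
  proof (cases "x = z")
    case True
    then show ?thesis using dy by simp
  next
    case False
    then have ne: "x \<noteq> z" "y \<noteq> z" using dy u by auto
    have "0 < dist z y" using ne by simp
    from at_right_0_eventually_bounds[OF this]
    have "\<forall>\<^sub>F s in at_right 0. chord_ratio (geod z y) (geod z x) s = 0"
    proof eventually_elim
      case (elim s)
      then have "s / dist z y \<in> {0..1}" "u * (s / dist z y) = s / dist z x"
        using u ne by (auto simp: dy)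
      then show ?case
        by (simp add: chord_ratio_def is_geodesic_ends[OF is_geodesic_geod] y y_def[symmetric])
    qed
    then have "(chord_ratio (geod z y) (geod z x) \<longlongrightarrow> 0) (at_right 0)"
      by (rule tendsto_eventually)
    then have "alexandrov_angle z (geod z y) (geod z x) = 0"
      using alexandrov_angle_eq_0_iff[OF is_geodesic_geod ne(2) is_geodesic_geod ne(1)] by simp
    then show ?thesis by (intro direction_eqI geod_in_geodesics_from)
  qed
  moreover have "inverse (u * l) * dist z y = inverse l * dist z x"
    using u by (simp add: dy)
  ultimately show ?thesis unfolding y_def[symmetric] tangent_vector_def by (simp only:)
qed

section \<open>Resolvents\<close>

text \<open>Multiplying monotonicity by \<open>dist z w\<close> lets
  \<open>tangent_inner_geod_ge\<close> replace both inner products, which leaves only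
  distances.\<close>

lemma resolvent_set_inequality:
  fixes A :: "'a \<Rightarrow> 'a tangent set"
  assumes mono: "monotone_vf A" and l: "0 < l" and m: "0 < m"
    and z: "z \<in> resolvent_set A l x" and w: "w \<in> resolvent_set A m y"
  shows "inverse l * ((dist z x)\<^sup>2 + (dist z w)\<^sup>2 - (dist x w)\<^sup>2)
    + inverse m * ((dist w y)\<^sup>2 + (dist w z)\<^sup>2 - (dist y z)\<^sup>2) \<le> 0"
proof -
  let ?f = "\<lambda>l z x w. tangent_inner z (tangent_vector z (inverse l * dist z x) (geod z x))
      (tangent_vector z 1 (geod z w))"
  have "?f l z x w \<le> - ?f m w y z"
    using mono z w unfolding monotone_vf_def resolvent_set_def by blast
  then have "?f l z x w * dist z w \<le> - ?f m w y z * dist z w"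
    by (rule mult_right_mono) simp
  with tangent_inner_geod_ge[of "inverse l" z x w] tangent_inner_geod_ge[of "inverse m" w y z] l m
  show ?thesis by (simp add: dist_commute)
qed

lemma resolvent_set_dist:
  fixes A :: "'a \<Rightarrow> 'a tangent set"
  assumes "monotone_vf A" and l: "0 < l"
    and "z \<in> resolvent_set A l x" "w \<in> resolvent_set A l y"
  shows "dist z w \<le> dist x y"
proof (cases "z = w")
  case False
  have "inverse l * ((dist z x)\<^sup>2 + (dist z w)\<^sup>2 - (dist x w)\<^sup>2
    + ((dist w y)\<^sup>2 + (dist w z)\<^sup>2 - (dist y z)\<^sup>2)) \<le> 0"
    using resolvent_set_inequality[OF assms(1) l l assms(3,4)] by (simp add: distrib_left)
  then have "(dist z x)\<^sup>2 + (dist z w)\<^sup>2 - (dist x w)\<^sup>2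
    + ((dist w y)\<^sup>2 + (dist w z)\<^sup>2 - (dist y z)\<^sup>2) \<le> 0"
    using l by (simp add: mult_le_0_iff)
  \<comment> \<open>The mixed terms \<open>dist x w\<close> and \<open>dist y z\<close> are the
    diagonals; bounding them leaves only \<open>dist z w\<close> and
    \<open>dist x y\<close>.\<close>
  with quadrilateral_inequality[of x w y z]
  have "2 * (dist z w)\<^sup>2 \<le> 2 * dist x y * dist z w"
    by (simp add: dist_commute)
  with False show ?thesis by (simp add: power2_eq_square)
qed simp

lemma resolvent_eqI:
  fixes A :: "'a \<Rightarrow> 'a tangent set"
  assumes "monotone_vf A" and l: "0 < l" and z: "z \<in> resolvent_set A l x"
  shows "resolvent A l x = z"
proof -
  have "resolvent_set A l x = {z}"
  proof (intro equalityI subsetI)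
    fix w assume "w \<in> resolvent_set A l x"
    from resolvent_set_dist[OF assms(1) l z this] show "w \<in> {z}" by simp
  qed (use z in simp)
  then show ?thesis using l by (simp add: resolvent_def)
qed

lemma resolvent_in_resolvent_set:
  fixes A :: "'a \<Rightarrow> 'a tangent set"
  assumes mono: "monotone_vf A" and surj: "surjectivity_condition A" and l: "0 < l"
  shows "resolvent A l x \<in> resolvent_set A l x"
proof -
  have "0 < inverse l" using l by simp
  then obtain z where "tangent_vector z (inverse l * dist z x) (geod z x) \<in> A z"
    using surj unfolding surjectivity_condition_def by blast
  then have z: "z \<in> resolvent_set A l x" by (simp add: resolvent_set_def)
  from resolvent_eqI[OF mono l z] z show ?thesis by simp
qed

text \<open>With step \<open>u\<close>, the intermediate point prescribes the same tangent vector at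
  \<open>resolvent A l x\<close> as \<open>x\<close> does with step \<open>l\<close>; uniqueness of
  the resolvent does the rest.\<close>

lemma resolvent_identity:
  fixes A :: "'a \<Rightarrow> 'a tangent set"
  assumes mono: "monotone_vf A" and surj: "surjectivity_condition A" and u: "0 < u" "u \<le> l"
  shows "resolvent A u (geod (resolvent A l x) x (u / l)) = resolvent A l x"
proof (rule resolvent_eqI[OF mono u(1)])
  have l: "0 < l" using u by simp
  define z where "z = resolvent A l x"
  have r: "0 < u / l" "u / l \<le> 1" and ul: "u / l * l = u" using u by auto
  have "tangent_vector z (inverse l * dist z x) (geod z x) \<in> A z"
    using resolvent_in_resolvent_set[OF mono surj l, of x] by (simp add: resolvent_set_def z_def)
  then show "resolvent A l x \<in> resolvent_set A u (geod (resolvent A l x) x (u / l))"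
    unfolding z_def[symmetric] resolvent_set_def mem_Collect_eq
    by (simp only: tangent_vector_geod_initial[OF r, of z l x, unfolded ul])
qed

text \<open>Monotonicity between a fixed \<open>v\<close> in \<open>A x\<close> and the vector at
  the resolvent bounds the length of the latter; \<open>L\<close> is the coefficient
  \<open>t\<close> in a representative of \<open>v\<close>.\<close>

lemma resolvent_slope:
  fixes A :: "'a \<Rightarrow> 'a tangent set"
  assumes vf: "vector_field A" and mono: "monotone_vf A" and surj: "surjectivity_condition A"
    and x: "x \<in> vf_dom A"
  shows "\<exists>L\<ge>0. \<forall>l>0. dist x (resolvent A l x) \<le> l * L"
proof -
  obtain v where v: "v \<in> A x" using x by (auto simp: vf_dom_def)
  then have "v \<in> tangent_space x" using vf by (auto simp: vector_field_def)
  then obtain t c where t: "0 \<le> t" and c: "c \<in> geodesics_from x" and vt: "v = tangent_vector x t c"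
    by (auto simp: tangent_space_def direction_space_def direction_def tangent_vector_def elim!: quotientE)
  show ?thesis
  proof (intro exI[of _ t] conjI allI impI t)
    fix l :: real assume l: "0 < l"
    define z where "z = resolvent A l x"
    have z: "tangent_vector z (inverse l * dist z x) (geod z x) \<in> A z"
      using resolvent_in_resolvent_set[OF mono surj l, of x] by (simp add: resolvent_set_def z_def)
    let ?a = "tangent_inner z (tangent_vector z (inverse l * dist z x) (geod z x))
        (tangent_vector z 1 (geod z x))"
    let ?b = "tangent_inner x v (tangent_vector x 1 (geod x z))"
    have "?b = t * 1 * zeta c * zeta (geod x z) * cos (alexandrov_angle x c (geod x z))"
      unfolding vt using tangent_inner_tangent_vector[OF c geod_in_geodesics_from t] by simp
    \<comment> \<open>Each \<open>zeta\<close> is 0 or 1, and the cosine is at least -1.\<close>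
    also have "- (t * 1 * zeta c * zeta (geod x z) * cos (alexandrov_angle x c (geod x z))) \<le> t"
      using t cos_ge_minus_one[of "alexandrov_angle x c (geod x z)"]
        mult_left_mono[of "-1" "cos (alexandrov_angle x c (geod x z))" t]
      by (auto simp: zeta_def)
    finally have "- ?b \<le> t" .
    moreover have "?a \<le> - ?b"
      using mono z v unfolding monotone_vf_def by blast
    ultimately have "?a * dist z x \<le> t * dist z x" by (intro mult_right_mono) auto
    with tangent_inner_geod_ge[of "inverse l" z x x] l
    have "inverse l * (dist z x)\<^sup>2 \<le> t * dist z x" by simp
    then have "dist z x \<le> l * t"
      using l t by (cases "z = x") (auto simp: power2_eq_square field_simps)
    then show "dist x (resolvent A l x) \<le> l * t" by (simp add: z_def dist_commute)
  qed
qed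

end

section \<open>The Crandall--Liggett estimate\<close>

text \<open>The gap between the mean of the squares and the square of the mean is
  \<open>a * b * (sqrt P - sqrt Q)^2\<close>.\<close>

lemma sqrt_concave:
  fixes a b P Q :: real
  assumes "0 \<le> a" "0 \<le> b" "a + b = 1" "0 \<le> P" "0 \<le> Q"
  shows "a * sqrt P + b * sqrt Q \<le> sqrt (a * P + b * Q)"
proof (rule real_le_rsqrt)
  have b: "b = 1 - a" using assms by simp
  have "a * (sqrt P)\<^sup>2 + b * (sqrt Q)\<^sup>2 - (a * sqrt P + b * sqrt Q)\<^sup>2
      = a * b * (sqrt P - sqrt Q)\<^sup>2"
    unfolding b by (simp add: power2_eq_square algebra_simps)
  then show "(a * sqrt P + b * sqrt Q)\<^sup>2 \<le> a * P + b * Q"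
    using assms by (smt (verit) mult_nonneg_nonneg real_sqrt_pow2 zero_le_power2)
qed

lemma dist_triangle3_sum: "dist x y \<le> dist x a + dist a b + dist y b"
  using dist_triangle[of x y a] dist_triangle[of a y b] by (simp add: dist_commute)

text \<open>The limit argument needs only these metric facts and completeness. The case
  \<open>u = l\<close> of \<open>J_rec\<close> is nonexpansiveness.\<close>

locale resolvent_family =
  fixes J :: "real \<Rightarrow> 'a::complete_space \<Rightarrow> 'a" and D :: "'a set"
  assumes J_0: "J 0 x = x"
    and J_in: "0 < l \<Longrightarrow> J l x \<in> D"
    and J_rec: "0 < u \<Longrightarrow> u \<le> l \<Longrightarrow>
      dist (J l x) (J u y) \<le> u / l * dist x y + (1 - u / l) * dist (J l x) y"
    and J_slope: "x \<in> D \<Longrightarrow> \<exists>L\<ge>0. \<forall>l>0. dist x (J l x) \<le> l * L"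
begin

lemma J_nonexpansive:
  assumes "0 \<le> l"
  shows "dist (J l x) (J l y) \<le> dist x y"
  using assms J_rec[of l l x y] by (cases "l = 0") (auto simp: J_0)

text \<open>Step size 0 does occur: for \<open>t = 0\<close>, and in the term
  \<open>t / real k\<close> with \<open>k = 0\<close>, where division by zero gives 0.\<close>

lemma J_rec0:
  assumes "0 \<le> u" "u \<le> l"
  shows "dist (J l x) (J u y) \<le> u / l * dist x y + (1 - u / l) * dist (J l x) y"
  using assms J_rec[of u l x y] by (cases "u = 0") (auto simp: J_0)

lemma iterate_nonexpansive:
  assumes "0 \<le> l"
  shows "dist ((J l ^^ k) x) ((J l ^^ k) y) \<le> dist x y"
proof (induction k)
  case (Suc k)
  then show ?case
    using J_nonexpansive[OF assms, of "(J l ^^ k) x" "(J l ^^ k) y"] by simp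
qed simp

lemma iterate_in_closure:
  assumes "0 \<le> l" "x \<in> closure D"
  shows "(J l ^^ k) x \<in> closure D"
proof (cases "l = 0 \<or> k = 0")
  case True
  have "(J 0 ^^ k) x = x" by (induction k) (auto simp: J_0)
  with True assms show ?thesis by auto
next
  case False
  then obtain k' where "k = Suc k'" by (cases k) auto
  with False assms J_in[of l] show ?thesis
    using closure_subset by fastforce
qed

text \<open>Any admissible constant serves, so an arbitrary one is chosen; it is meaningful for
  \<open>x\<close> in \<open>D\<close>.\<close>

definition slope :: "'a \<Rightarrow> real" where
  "slope x = (SOME L. L \<ge> 0 \<and> (\<forall>l>0. dist x (J l x) \<le> l * L))"

lemma
  assumes "x \<in> D"
  shows slope_nonneg: "slope x \<ge> 0"
    and slope_bound: "0 \<le> l \<Longrightarrow> dist x (J l x) \<le> l * slope x"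
proof -
  have *: "slope x \<ge> 0 \<and> (\<forall>l>0. dist x (J l x) \<le> l * slope x)"
    unfolding slope_def by (rule someI_ex) (use J_slope[OF assms] in blast)
  then show "slope x \<ge> 0" by blast
  show "dist x (J l x) \<le> l * slope x" if "0 \<le> l"
    using * that by (cases "l = 0") (auto simp: J_0)
qed

lemma iterate_slope_bound:
  assumes "x \<in> D" "0 \<le> l"
  shows "dist x ((J l ^^ k) x) \<le> real k * l * slope x"
proof (induction k)
  case (Suc k)
  have "dist x ((J l ^^ Suc k) x) \<le> dist x (J l x) + dist (J l x) (J l ((J l ^^ k) x))"
    by (simp add: dist_triangle)
  also have "\<dots> \<le> l * slope x + real k * l * slope x"
    using slope_bound[OF assms] J_nonexpansive[OF assms(2), of x "(J l ^^ k) x"] Suc by linarith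
  finally show ?case by (simp add: algebra_simps)
qed simp

text \<open>With weights \<open>a = u / l\<close> and \<open>1 - a\<close>, the number \<open>w = m l - n u\<close> is the mean of its two
  predecessors \<open>w + u - l\<close> and \<open>w + u\<close>, whose variance is \<open>u (l - u)\<close>. So the square of the
  bound grows by exactly that amount in each step, and concavity of the square root closes the
  induction.\<close>

lemma iterate_dist_ordered:
  assumes x: "x \<in> D" and ul: "0 \<le> u" "u \<le> l"
  shows "dist ((J l ^^ m) x) ((J u ^^ n) x)
    \<le> slope x * sqrt ((real m * l - real n * u)\<^sup>2 + real n * u * (l - u))"
proof (induction n arbitrary: m)
  case 0
  show ?case
    using iterate_slope_bound[OF x, of l m] ul by (simp add: dist_commute mult_ac)
next
  case (Suc n)
  show ?case
  proof (cases m)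
    case 0
    \<comment> \<open>At \<open>m = 0\<close> the linear slope bound already suffices, since the
      variance term only enlarges the radicand.\<close>
    have "real (Suc n) * u = sqrt ((real (Suc n) * u)\<^sup>2)"
      using ul by (metis abs_of_nonneg mult_nonneg_nonneg of_nat_0_le_iff real_sqrt_abs)
    also have "\<dots> \<le> sqrt ((0 * l - real (Suc n) * u)\<^sup>2 + real (Suc n) * u * (l - u))"
      using ul by (intro real_sqrt_le_mono) simp
    finally have "real (Suc n) * u * slope x
        \<le> sqrt ((0 * l - real (Suc n) * u)\<^sup>2 + real (Suc n) * u * (l - u)) * slope x"
      using slope_nonneg[OF x] by (rule mult_right_mono)
    with iterate_slope_bound[OF x ul(1), of "Suc n"] show ?thesis
      by (simp only: 0 funpow_0 of_nat_0) (simp add: mult.commute)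
  next
    case (Suc m')
    define a where "a = u / l"
    define w where "w = real m * l - real (Suc n) * u"
    define v where "v = real n * u * (l - u)"
    have a: "0 \<le> a" "a \<le> 1" "a * l = u"
      using ul by (auto simp: a_def divide_le_eq)
    have v: "0 \<le> v" using ul by (simp add: v_def)
    have "dist ((J l ^^ m) x) ((J u ^^ Suc n) x)
        \<le> a * dist ((J l ^^ m') x) ((J u ^^ n) x) + (1 - a) * dist ((J l ^^ m) x) ((J u ^^ n) x)"
      using J_rec0[OF ul] by (simp add: Suc a_def)
    also have "\<dots> \<le> a * (slope x * sqrt ((w + u - l)\<^sup>2 + v)) + (1 - a) * (slope x * sqrt ((w + u)\<^sup>2 + v))"
    proof (intro add_mono mult_left_mono)
      show "dist ((J l ^^ m') x) ((J u ^^ n) x) \<le> slope x * sqrt ((w + u - l)\<^sup>2 + v)"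
        using Suc.IH[of m'] by (simp add: w_def v_def Suc algebra_simps)
      show "dist ((J l ^^ m) x) ((J u ^^ n) x) \<le> slope x * sqrt ((w + u)\<^sup>2 + v)"
        using Suc.IH[of m] by (simp add: w_def v_def algebra_simps)
    qed (use a in auto)
    also have "\<dots> = slope x * (a * sqrt ((w + u - l)\<^sup>2 + v) + (1 - a) * sqrt ((w + u)\<^sup>2 + v))"
      by (simp add: algebra_simps)
    also have "\<dots> \<le> slope x * sqrt (a * ((w + u - l)\<^sup>2 + v) + (1 - a) * ((w + u)\<^sup>2 + v))"
      using a v slope_nonneg[OF x] by (intro mult_left_mono sqrt_concave) auto
    also have "a * ((w + u - l)\<^sup>2 + v) + (1 - a) * ((w + u)\<^sup>2 + v)
        = w\<^sup>2 + real (Suc n) * u * (l - u)"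
      unfolding a(3)[symmetric] v_def by (simp add: power2_eq_square algebra_simps)
    finally show ?thesis by (simp add: w_def)
  qed
qed

text \<open>Weaker than the ordered bound but symmetric in the two step sizes, so that step
  sequences in no fixed order can be compared.\<close>

lemma iterate_dist:
  assumes x: "x \<in> D" and "0 \<le> u" "0 \<le> l"
  shows "dist ((J l ^^ m) x) ((J u ^^ n) x)
    \<le> slope x * sqrt ((real m * l - real n * u)\<^sup>2 + real m * l * u + real n * u * l)"
proof -
  have *: "dist ((J l ^^ m) x) ((J u ^^ n) x)
      \<le> slope x * sqrt ((real m * l - real n * u)\<^sup>2 + real m * l * u + real n * u * l)"
    if "0 \<le> u" "u \<le> l" for u l m n
  proof (rule order_trans[OF iterate_dist_ordered[OF x that]])
    have "real n * u * (l - u) \<le> real m * l * u + real n * u * l"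
      using that by (simp add: algebra_simps add_increasing2)
    then show "slope x * sqrt ((real m * l - real n * u)\<^sup>2 + real n * u * (l - u))
        \<le> slope x * sqrt ((real m * l - real n * u)\<^sup>2 + real m * l * u + real n * u * l)"
      using slope_nonneg[OF x] by (intro mult_left_mono real_sqrt_le_mono) auto
  qed
  show ?thesis
  proof (cases "u \<le> l")
    case True
    with assms show ?thesis by (intro *)
  next
    case False
    with *[of l u n m] assms show ?thesis
      by (simp add: dist_commute power2_commute add_ac)
  qed
qed

text \<open>The last two terms of the radicand are a convergent total time multiplied by a vanishing
  step. The case \<open>t = s\<close> gives independence of the steps, the general case Lipschitz
  continuity in time.\<close>

lemma iterate_asymp:
  assumes x: "x \<in> D" and pos: "\<And>n. 0 \<le> l n" "\<And>n. 0 \<le> u n"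
    and l: "l \<longlonglongrightarrow> 0" and u: "u \<longlonglongrightarrow> 0"
    and t: "(\<lambda>n. real (p n) * l n) \<longlonglongrightarrow> t" and s: "(\<lambda>n. real (q n) * u n) \<longlonglongrightarrow> s"
    and e: "0 < e"
  shows "\<forall>\<^sub>F n in sequentially.
    dist ((J (l n) ^^ p n) x) ((J (u n) ^^ q n) x) < slope x * \<bar>t - s\<bar> + e"
proof -
  define B where "B n = slope x * sqrt ((real (p n) * l n - real (q n) * u n)\<^sup>2
      + real (p n) * l n * u n + real (q n) * u n * l n)" for n
  have "B \<longlonglongrightarrow> slope x * sqrt ((t - s)\<^sup>2 + t * 0 + s * 0)"
    unfolding B_def by (intro tendsto_intros l u t s)
  then have "\<forall>\<^sub>F n in sequentially. B n < slope x * \<bar>t - s\<bar> + e"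
    using e by (intro order_tendstoD(2)) auto
  then show ?thesis
  proof eventually_elim
    case (elim n)
    then show ?case
      using iterate_dist[OF x pos(2)[of n] pos(1)[of n], of "p n" "q n"] by (simp add: B_def)
  qed
qed

text \<open>Nonexpansive iterates allow \<open>x\<close> to be replaced by a nearby \<open>y\<close>
  in \<open>D\<close>. The slope of \<open>y\<close>, over which there is no control, is multiplied
  by \<open>\<bar>t - t\<bar>\<close>.\<close>

lemma iterate_asymp_closure:
  assumes x: "x \<in> closure D" and pos: "\<And>n. 0 \<le> l n" "\<And>n. 0 \<le> u n"
    and l: "l \<longlonglongrightarrow> 0" and u: "u \<longlonglongrightarrow> 0"
    and t: "(\<lambda>n. real (p n) * l n) \<longlonglongrightarrow> t" "(\<lambda>n. real (q n) * u n) \<longlonglongrightarrow> t"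
  shows "(\<lambda>n. dist ((J (l n) ^^ p n) x) ((J (u n) ^^ q n) x)) \<longlonglongrightarrow> 0"
proof (rule tendstoI)
  fix e :: real assume e: "0 < e"
  obtain y where y: "y \<in> D" "dist y x < e / 3"
    using x e closure_approachable[of x D] by (metis zero_less_divide_iff zero_less_numeral)
  have "\<forall>\<^sub>F n in sequentially. dist ((J (l n) ^^ p n) y) ((J (u n) ^^ q n) y)
      < slope y * \<bar>t - t\<bar> + e / 3"
    by (rule iterate_asymp) (use y e assms in auto)
  then show "\<forall>\<^sub>F n in sequentially. dist (dist ((J (l n) ^^ p n) x) ((J (u n) ^^ q n) x)) 0 < e"
  proof eventually_elim
    case (elim n)
    have "dist ((J (l n) ^^ p n) x) ((J (l n) ^^ p n) y) < e / 3"
      "dist ((J (u n) ^^ q n) x) ((J (u n) ^^ q n) y) < e / 3"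
      using iterate_nonexpansive[OF pos(1)[of n], of "p n" x y]
        iterate_nonexpansive[OF pos(2)[of n], of "q n" x y] y by (auto simp: dist_commute)
    with elim dist_triangle3_sum[of "(J (l n) ^^ p n) x" "(J (u n) ^^ q n) x"
        "(J (l n) ^^ p n) y" "(J (u n) ^^ q n) y"]
    have "dist ((J (l n) ^^ p n) x) ((J (u n) ^^ q n) x) < e"
      by simp
    then show ?case by simp
  qed
qed

text \<open>With steps \<open>t / m\<close> and \<open>t / n\<close> both total times are
  \<open>t\<close>, so the bound is the slope times \<open>sqrt (t^2 / m + t^2 / n)\<close>. The
  point \<open>y\<close> in \<open>D\<close> is fixed before \<open>N\<close>, since
  \<open>N\<close> depends on its slope.\<close>

lemma convergent_iterate:
  assumes x: "x \<in> closure D" and t: "0 \<le> t"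
  shows "convergent (\<lambda>k. (J (t / real k) ^^ k) x)"
proof (rule Cauchy_convergent, rule metric_CauchyI)
  fix e :: real assume e: "0 < e"
  obtain y where y: "y \<in> D" "dist y x < e / 3"
    using x e closure_approachable[of x D] by (metis zero_less_divide_iff zero_less_numeral)
  let ?J = "\<lambda>n x. (J (t / real n) ^^ n) x"
  have "(\<lambda>n. slope y * sqrt (2 * t\<^sup>2 * inverse (real (Suc n)))) \<longlonglongrightarrow> slope y * sqrt (2 * t\<^sup>2 * 0)"
    by (intro tendsto_intros LIMSEQ_inverse_real_of_nat)
  then have "\<forall>\<^sub>F n in sequentially. slope y * sqrt (2 * t\<^sup>2 * inverse (real (Suc n))) < e / 3"
    using e by (intro order_tendstoD(2)) auto
  then obtain N where N: "slope y * sqrt (2 * t\<^sup>2 * inverse (real (Suc N))) < e / 3"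
    by (auto simp: eventually_sequentially)
  show "\<exists>M. \<forall>m\<ge>M. \<forall>n\<ge>M. dist (?J m x) (?J n x) < e"
  proof (intro exI[of _ "Suc N"] allI impI)
    \<comment> \<open>Starting at \<open>Suc N\<close> keeps \<open>m\<close> and \<open>n\<close>
      positive, so that \<open>real m * (t / real m)\<close> is \<open>t\<close>.\<close>
    fix m n assume mn: "Suc N \<le> m" "Suc N \<le> n"
    have inv: "inverse (real m) \<le> inverse (real (Suc N))" "inverse (real n) \<le> inverse (real (Suc N))"
      using mn by (auto intro!: le_imp_inverse_le)
    have "dist (?J m y) (?J n y) \<le> slope y * sqrt ((real m * (t / real m) - real n * (t / real n))\<^sup>2
        + real m * (t / real m) * (t / real n) + real n * (t / real n) * (t / real m))"
      using t by (intro iterate_dist y) auto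
    also have "(real m * (t / real m) - real n * (t / real n))\<^sup>2
        + real m * (t / real m) * (t / real n) + real n * (t / real n) * (t / real m)
        = t\<^sup>2 * inverse (real m) + t\<^sup>2 * inverse (real n)"
      using mn by (simp add: field_simps power2_eq_square)
    also have "\<dots> \<le> t\<^sup>2 * inverse (real (Suc N)) + t\<^sup>2 * inverse (real (Suc N))"
      by (intro add_mono mult_left_mono inv) auto
    also have "\<dots> = 2 * t\<^sup>2 * inverse (real (Suc N))" by simp
    finally have "dist (?J m y) (?J n y) \<le> slope y * sqrt (2 * t\<^sup>2 * inverse (real (Suc N)))"
      using slope_nonneg[OF y(1)] by (simp add: mult_left_mono)
    then have 1: "dist (?J m y) (?J n y) < e / 3" using N by simp
    have 2: "dist (?J m x) (?J m y) < e / 3" "dist (?J n x) (?J n y) < e / 3"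
      using iterate_nonexpansive[of "t / real m" m x y]
        iterate_nonexpansive[of "t / real n" n x y] t y by (auto simp: dist_commute)
    with 1 dist_triangle3_sum[of "?J m x" "?J n x" "?J m y" "?J n y"] show "dist (?J m x) (?J n x) < e" by linarith
  qed
qed

section \<open>The limit semigroup\<close>

definition S :: "real \<Rightarrow> 'a \<Rightarrow> 'a" where
  "S t x = lim (\<lambda>k. (J (t / real k) ^^ k) x)"

lemma iterate_tendsto_S:
  assumes "x \<in> closure D" "0 \<le> t"
  shows "(\<lambda>k. (J (t / real k) ^^ k) x) \<longlonglongrightarrow> S t x"
  unfolding S_def using convergent_iterate[OF assms] by (simp add: convergent_LIMSEQ_iff)

lemma tendsto_div_nat: "(\<lambda>n. t / real n) \<longlonglongrightarrow> (0::real)"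
  by (rule lim_const_over_n)

lemma tendsto_nat_times_div: "(\<lambda>n. real n * (t / real n)) \<longlonglongrightarrow> t"
  by (rule tendsto_eventually) (auto simp: eventually_sequentially intro!: exI[of _ 1])

text \<open>Comparison with the defining sequence of steps \<open>t / n\<close>. The freedom in the
  steps is what the semigroup law rests on.\<close>

lemma general_iterate_tendsto_S:
  assumes x: "x \<in> closure D" and t: "0 \<le> t" and pos: "\<And>n. 0 \<le> l n" and l: "l \<longlonglongrightarrow> 0"
    and p: "(\<lambda>n. real (p n) * l n) \<longlonglongrightarrow> t"
  shows "(\<lambda>n. (J (l n) ^^ p n) x) \<longlonglongrightarrow> S t x"
proof -
  have "(\<lambda>n. dist ((J (l n) ^^ p n) x) ((J (t / real n) ^^ n) x)) \<longlonglongrightarrow> 0"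
    by (rule iterate_asymp_closure[OF x pos _ l tendsto_div_nat p tendsto_nat_times_div])
      (use t in auto)
  moreover have "(\<lambda>n. dist ((J (t / real n) ^^ n) x) (S t x)) \<longlonglongrightarrow> 0"
    by (rule tendsto_dist_iff[THEN iffD1, OF iterate_tendsto_S[OF x t]])
  ultimately have "(\<lambda>n. dist ((J (l n) ^^ p n) x) ((J (t / real n) ^^ n) x)
      + dist ((J (t / real n) ^^ n) x) (S t x)) \<longlonglongrightarrow> 0"
    using tendsto_add_zero by blast
  then have "(\<lambda>n. dist ((J (l n) ^^ p n) x) (S t x)) \<longlonglongrightarrow> 0"
    by (rule Lim_null_comparison[rotated]) (simp add: dist_triangle always_eventually)
  then show ?thesis by (rule tendsto_dist_iff[THEN iffD2])
qed

lemma S_in: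
  assumes "x \<in> closure D" "0 \<le> t"
  shows "S t x \<in> closure D"
proof (rule Lim_in_closed_set[OF closed_closure _ _ iterate_tendsto_S[OF assms]])
  have "0 \<le> t / real n" for n using assms by simp
  then show "\<forall>\<^sub>F n in sequentially. (J (t / real n) ^^ n) x \<in> closure D"
    by (intro always_eventually allI iterate_in_closure assms)
qed simp

lemma S_nonexpansive:
  assumes "x \<in> closure D" "y \<in> closure D" "0 \<le> t"
  shows "dist (S t x) (S t y) \<le> dist x y"
proof (rule tendsto_upperbound)
  show "(\<lambda>k. dist ((J (t / real k) ^^ k) x) ((J (t / real k) ^^ k) y)) \<longlonglongrightarrow> dist (S t x) (S t y)"
    by (intro tendsto_dist iterate_tendsto_S assms)
  have "0 \<le> t / real n" for n using assms by simp
  then show "\<forall>\<^sub>F n in sequentially. dist ((J (t / real n) ^^ n) x) ((J (t / real n) ^^ n) y) \<le> dist x y"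
    by (intro always_eventually allI iterate_nonexpansive)
qed simp

lemma S_0: "S 0 x = x"
proof -
  have "(J 0 ^^ k) x = x" for k by (induction k) (auto simp: J_0)
  then show ?thesis by (simp add: S_def)
qed

text \<open>With the common step \<open>1 / n\<close>, running about \<open>t n\<close> and then
  about \<open>s n\<close> steps is one iterate with added exponents. By nonexpansiveness the inner
  iterate may be replaced by its limit \<open>S t x\<close>.\<close>

lemma S_add:
  assumes x: "x \<in> closure D" and st: "0 \<le> s" "0 \<le> t"
  shows "S (s + t) x = S s (S t x)"
proof -
  define p where "p r n = nat \<lfloor>r * real n\<rfloor>" for r n
  define l where "l n = 1 / real n" for n :: nat
  have l: "l \<longlonglongrightarrow> 0" "0 \<le> l n" for n
    unfolding l_def by (auto intro: lim_const_over_n)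
  have p: "(\<lambda>n. real (p r n) * l n) \<longlonglongrightarrow> r" if "0 \<le> r" for r
  proof (rule real_tendsto_sandwich)
    show "(\<lambda>n. r - l n) \<longlonglongrightarrow> r" using tendsto_diff[OF tendsto_const l(1), of r] by simp
    \<comment> \<open>Rounding down loses less than one step, so the elapsed time lies between
      \<open>r - 1 / n\<close> and \<open>r\<close>.\<close>
    have *: "real_of_int \<lfloor>r * real n\<rfloor> = real (p r n)" for n using that by (simp add: p_def)
    have "r * real n - 1 \<le> real (p r n)" "real (p r n) \<le> r * real n" for n
      using *[of n] by linarith+
    then show "\<forall>\<^sub>F n in sequentially. r - l n \<le> real (p r n) * l n"
      "\<forall>\<^sub>F n in sequentially. real (p r n) * l n \<le> r"
      by (auto simp: eventually_sequentially l_def field_simps intro!: exI[of _ 1])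
  qed simp_all
  have conv: "(\<lambda>n. (J (l n) ^^ q n) y) \<longlonglongrightarrow> S r y"
    if "(\<lambda>n. real (q n) * l n) \<longlonglongrightarrow> r" "y \<in> closure D" "0 \<le> r" for q r y
    by (rule general_iterate_tendsto_S[OF that(2,3) l(2,1) that(1)])
  let ?a = "\<lambda>n. (J (l n) ^^ p s n) ((J (l n) ^^ p t n) x)"
  have "(\<lambda>n. real (p s n + p t n) * l n) \<longlonglongrightarrow> s + t"
    using tendsto_add[OF p p] st by (simp add: algebra_simps)
  from conv[OF this x] st have 1: "?a \<longlonglongrightarrow> S (s + t) x"
    by (simp add: funpow_add)
  have "(\<lambda>n. dist ((J (l n) ^^ p t n) x) (S t x)) \<longlonglongrightarrow> 0"
    by (rule tendsto_dist_iff[THEN iffD1, OF conv[OF p[OF st(2)] x st(2)]])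
  then have "(\<lambda>n. dist (?a n) ((J (l n) ^^ p s n) (S t x))) \<longlonglongrightarrow> 0"
    by (rule Lim_null_comparison[rotated])
      (auto intro!: always_eventually iterate_nonexpansive l)
  moreover have "(\<lambda>n. dist ((J (l n) ^^ p s n) (S t x)) (S s (S t x))) \<longlonglongrightarrow> 0"
    by (rule tendsto_dist_iff[THEN iffD1, OF conv[OF p[OF st(1)] S_in[OF x st(2)] st(1)]])
  ultimately have "(\<lambda>n. dist (?a n) ((J (l n) ^^ p s n) (S t x))
      + dist ((J (l n) ^^ p s n) (S t x)) (S s (S t x))) \<longlonglongrightarrow> 0"
    using tendsto_add_zero by blast
  then have "(\<lambda>n. dist (?a n) (S s (S t x))) \<longlonglongrightarrow> 0"
    by (rule Lim_null_comparison[rotated]) (simp add: dist_triangle always_eventually)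
  then have 2: "?a \<longlonglongrightarrow> S s (S t x)" by (rule tendsto_dist_iff[THEN iffD2])
  from 1 2 show ?thesis by (rule LIMSEQ_unique)
qed

lemma S_lipschitz_time:
  assumes x: "x \<in> D" and st: "0 \<le> s" "0 \<le> t"
  shows "dist (S t x) (S s x) \<le> slope x * \<bar>t - s\<bar>"
proof (rule field_le_epsilon)
  fix e :: real assume e: "0 < e"
  have x': "x \<in> closure D" using x closure_subset by blast
  have "\<forall>\<^sub>F n in sequentially.
    dist ((J (t / real n) ^^ n) x) ((J (s / real n) ^^ n) x) < slope x * \<bar>t - s\<bar> + e"
    by (rule iterate_asymp[OF x _ _ tendsto_div_nat tendsto_div_nat
          tendsto_nat_times_div tendsto_nat_times_div e]) (use st in auto)
  then have "\<forall>\<^sub>F n in sequentially.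
    dist ((J (t / real n) ^^ n) x) ((J (s / real n) ^^ n) x) \<le> slope x * \<bar>t - s\<bar> + e"
    by eventually_elim simp
  then show "dist (S t x) (S s x) \<le> slope x * \<bar>t - s\<bar> + e"
    by (rule tendsto_upperbound[rotated]) (auto intro!: tendsto_dist iterate_tendsto_S x' st)
qed

text \<open>A Lipschitz bound in time is at hand only on \<open>D\<close>; approximating
  \<open>x\<close> by a single \<open>y\<close> in \<open>D\<close> still gives continuity.\<close>

lemma S_continuous:
  assumes x: "x \<in> closure D"
  shows "continuous_on {0..} (\<lambda>t. S t x)"
  unfolding continuous_on_iff
proof (intro ballI allI impI)
  fix t e :: real assume t: "t \<in> {0..}" and e: "0 < e"
  obtain y where y: "y \<in> D" "dist y x < e / 3"
    using x e closure_approachable[of x D] by (metis zero_less_divide_iff zero_less_numeral)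
  have y': "y \<in> closure D" using y closure_subset by blast
  \<comment> \<open>Adding 1 keeps the denominator positive when the slope is 0.\<close>
  define d where "d = e / (3 * (slope y + 1))"
  have sl: "0 \<le> slope y" by (rule slope_nonneg[OF y(1)])
  show "\<exists>d>0. \<forall>s\<in>{0..}. dist s t < d \<longrightarrow> dist (S s x) (S t x) < e"
  proof (intro exI[of _ d] conjI ballI impI)
    show "0 < d" using e sl by (simp add: d_def)
    fix s :: real assume s: "s \<in> {0..}" and "dist s t < d"
    then have "slope y * \<bar>s - t\<bar> \<le> slope y * d"
      using sl by (intro mult_left_mono) (auto simp: dist_real_def)
    also have "\<dots> < (slope y + 1) * d" using \<open>0 < d\<close> by simp
    also have "\<dots> = e / 3" using sl by (simp add: d_def field_simps)
    finally have "dist (S s y) (S t y) < e / 3"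
      using S_lipschitz_time[of y t s] y s t by simp
    moreover have "dist (S s x) (S s y) < e / 3" "dist (S t x) (S t y) < e / 3"
      using S_nonexpansive[OF x y', of s] S_nonexpansive[OF x y', of t] y s t
      by (auto simp: dist_commute)
    ultimately show "dist (S s x) (S t x) < e"
      using dist_triangle3_sum[of "S s x" "S t x" "S s y" "S t y"] by linarith
  qed
qed

lemma nonexpansive_semigroup_S: "nonexpansive_semigroup (closure D) S"
  unfolding nonexpansive_semigroup_def
  using S_in S_nonexpansive S_0 S_add S_continuous
  by (intro conjI ballI allI impI lipschitz_onI image_subsetI) simp_all

end

section \<open>Application to monotone vector fields\<close>

lemma resolvent_family_resolvent:
  fixes A :: "'a::complete_space \<Rightarrow> 'a tangent set"
  assumes cat0: "CAT0 TYPE('a)"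
    and vf: "vector_field A" and mono: "monotone_vf A" and surj: "surjectivity_condition A"
  shows "resolvent_family (resolvent A) (vf_dom A)"
proof
  show "resolvent A 0 x = x" for x by (simp add: resolvent_def)
  show "resolvent A l x \<in> vf_dom A" if "0 < l" for l x
    using resolvent_in_resolvent_set[OF cat0 mono surj that, of x]
    by (auto simp: resolvent_set_def vf_dom_def)
  show "\<exists>L\<ge>0. \<forall>l>0. dist x (resolvent A l x) \<le> l * L" if "x \<in> vf_dom A" for x
    by (rule resolvent_slope[OF cat0 vf mono surj that])
next
  fix u l :: real and x y :: 'a
  assume u: "0 < u" "u \<le> l"
  let ?J = "resolvent A"
  \<comment> \<open>The resolvent identity brings both points to the common step \<open>u\<close>;
    nonexpansiveness of \<open>?J u\<close> and convexity of the distance to \<open>y\<close> then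
    give the recursion.\<close>
  have "dist (?J l x) (?J u y) = dist (?J u (geod (?J l x) x (u / l))) (?J u y)"
    by (simp add: resolvent_identity[OF cat0 mono surj u])
  also have "\<dots> \<le> dist (geod (?J l x) x (u / l)) y"
    by (intro resolvent_set_dist[OF cat0 mono u(1)] resolvent_in_resolvent_set[OF cat0 mono surj u(1)])
  also have "\<dots> \<le> (1 - u / l) * dist y (?J l x) + u / l * dist y x"
    using dist_geod_convex[OF cat0, of "u / l" y "?J l x" x] u by (simp add: dist_commute)
  finally show "dist (?J l x) (?J u y) \<le> u / l * dist x y + (1 - u / l) * dist (?J l x) y"
    by (simp add: dist_commute)
qed

theorem theorem5p3:
  fixes A :: "'a::complete_space \<Rightarrow> 'a tangent set"
  assumes "CAT0 TYPE('a)"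
    and "geodesic_extension_property TYPE('a)"
    and "vector_field A"
    and "monotone_vf A"
    and "surjectivity_condition A"
  shows "(\<forall>t\<ge>0. \<forall>x\<in>closure (vf_dom A). convergent (resolvent_iter A t x)) \<and>
         nonexpansive_semigroup (closure (vf_dom A)) (exp_semigroup A)"
proof -
  interpret resolvent_family "resolvent A" "vf_dom A"
    by (rule resolvent_family_resolvent[OF assms(1,3,4,5)])
  have iter: "resolvent_iter A t x = (\<lambda>k. (resolvent A (t / real k) ^^ k) x)" for t x
    by (rule ext) (simp add: resolvent_iter_def)
  have "exp_semigroup A = S"
    by (intro ext) (simp add: exp_semigroup_def S_def iter)
  then show ?thesis
    using nonexpansive_semigroup_S convergent_iterate by (simp add: iter)
qed

end
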